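(* Let $(\Omega,\preccurlyeq)$ be a definable downward (respectively upward) directed set. Then there exists a definable map $\gamma: R^{>0}\times R^{>0}\rightarrow \Omega$ which is downward (respectively upward) cofinal from $(R^{>0}\times R^{>0},\trianglelefteq)$ to $(\Omega,\preccurlyeq)$.
   Context: Standing assumptions: $\mathcal{R}=(R,0,+,<,\ldots)$ is an o-minimal expansion of an ordered group, and "definable" means definable in $\mathcal{R}$ with parameters from $R$. $R^{>0}=\{t\in R: t>0\}$. A definable preordered set is a definable set $\Omega\subseteq R^n$ with a definable preorder (reflexive, transitive relation) $\preccurlyeq$; it is downward directed if $\Omega\neq\emptyset$ and every finite subset of $\Omega$ has a lower bound, i.e. some $v$ with $v\preccurlyeq u$ for all $u$ in the subset; it is upward directed if it is downward directed for the dual preorder. On $R^{>0}\times R^{>0}$ define the preorder $(s,t)\trianglelefteq(s',t')$ iff $s\le s'$ and $t\ge t'$. A map $\gamma:(\Omega',\preccurlyeq')\to(\Omega,\preccurlyeq)$ between preordered sets is downward cofinal if for every $u\in\Omega$ there is $v\in\Omega'$ such that $w\preccurlyeq' v$ implies $\gamma(w)\preccurlyeq u$; it is upward cofinal if for every $u\in\Omega$ there is $v\in\Omega'$ such that $w\preccurlyeq' v$ implies $u\preccurlyeq\gamma(w)$. *)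

theory Defs
  imports Main "HOL-Library.FuncSet" "HOL-Library.More_List"
begin

(* Commutativity is deliberately not assumed, so this is not linordered_ab_group_add. *)
class linordered_group_add = group_add + linorder +
  assumes group_add_strict_left_mono: "a < b \<Longrightarrow> c + a < c + b"
    and group_add_strict_right_mono: "a < b \<Longrightarrow> a + c < b + c"

(* First-order formulas over the language consisting of +, <, = and arbitrarily many further
   function and relation symbols, indexed by 'f and 'r. A symbol is an index together with the
   number of arguments it is applied to; a structure whose symbols have fixed arities is
   obtained by interpreting the superfluous symbols as constantly 0 and False.
   Every element of the universe is available as a constant (a parameter), including 0. *)

datatype ('a, 'f) fo_term =
    Var nat
  | Const 'a
  | Plus "('a, 'f) fo_term" "('a, 'f) fo_term"
  | Fun 'f "('a, 'f) fo_term list"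

datatype ('a, 'f, 'r) fo_formula =
    Eq "('a, 'f) fo_term" "('a, 'f) fo_term"
  | Less "('a, 'f) fo_term" "('a, 'f) fo_term"
  | Rel 'r "('a, 'f) fo_term list"
  | Neg "('a, 'f, 'r) fo_formula"
  | Conj "('a, 'f, 'r) fo_formula" "('a, 'f, 'r) fo_formula"
  | Exists nat "('a, 'f, 'r) fo_formula"

(* An expansion (R,0,+,<,...) of the ordered group on the type 'a is given by the
   interpretation of the additional symbols. *)
record ('a, 'f, 'r) expansion =
  fun_interp :: "'f \<Rightarrow> 'a list \<Rightarrow> 'a"
  rel_interp :: "'r \<Rightarrow> 'a list \<Rightarrow> bool"

primrec term_val ::
  "('a::plus, 'f, 'r) expansion \<Rightarrow> (nat \<Rightarrow> 'a) \<Rightarrow> ('a, 'f) fo_term \<Rightarrow> 'a" where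
  "term_val M e (Var i) = e i"
| "term_val M e (Const a) = a"
| "term_val M e (Plus s t) = term_val M e s + term_val M e t"
| "term_val M e (Fun f ts) = fun_interp M f (map (term_val M e) ts)"

primrec sat ::
  "('a::{plus, ord}, 'f, 'r) expansion \<Rightarrow> (nat \<Rightarrow> 'a) \<Rightarrow> ('a, 'f, 'r) fo_formula \<Rightarrow> bool" where
  "sat M e (Eq s t) \<longleftrightarrow> term_val M e s = term_val M e t"
| "sat M e (Less s t) \<longleftrightarrow> term_val M e s < term_val M e t"
| "sat M e (Rel r ts) \<longleftrightarrow> rel_interp M r (map (term_val M e) ts)"
| "sat M e (Neg \<phi>) \<longleftrightarrow> \<not> sat M e \<phi>"
| "sat M e (Conj \<phi> \<psi>) \<longleftrightarrow> sat M e \<phi> \<and> sat M e \<psi>"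
| "sat M e (Exists i \<phi>) \<longleftrightarrow> (\<exists>a. sat M (e(i := a)) \<phi>)"

(* Points of R^n are lists of length n. Free variables with index at least n are evaluated
   to 0, that is, they act as the parameter 0. *)
definition definable ::
  "('a::{zero, plus, ord}, 'f, 'r) expansion \<Rightarrow> nat \<Rightarrow> 'a list set \<Rightarrow> bool" where
  "definable M n X \<longleftrightarrow> (\<exists>\<phi>. X = {xs. length xs = n \<and> sat M (nth_default 0 xs) \<phi>})"

definition points_and_intervals :: "'a::linorder set set" where
  "points_and_intervals =
     {{a} | a. True} \<union> {{a<..<b} | a b. True} \<union> {{a<..} | a. True} \<union> {{..<b} | b. True} \<union> {UNIV}"

definition o_minimal ::
  "('a::{linordered_group_add, unbounded_dense_linorder}, 'f, 'r) expansion \<Rightarrow> bool" where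
  "o_minimal M \<longleftrightarrow>
     (\<forall>X. definable M 1 X \<longrightarrow>
        (\<exists>F. finite F \<and> F \<subseteq> points_and_intervals \<and> {x. [x] \<in> X} = \<Union>F))"

definition definable_preordered_set ::
  "('a::{zero, plus, ord}, 'f, 'r) expansion \<Rightarrow> nat \<Rightarrow> 'a list set \<Rightarrow> 'a list rel \<Rightarrow> bool" where
  "definable_preordered_set M n \<Omega> r \<longleftrightarrow>
     definable M n \<Omega> \<and> preorder_on \<Omega> r \<and> definable M (n + n) {x @ y | x y. (x, y) \<in> r}"

(* Here and below, (x, y) \<in> r is read as: x precedes y. *)
definition downward_directed :: "'b set \<Rightarrow> 'b rel \<Rightarrow> bool" where
  "downward_directed \<Omega> r \<longleftrightarrow>
     \<Omega> \<noteq> {} \<and> (\<forall>U. finite U \<longrightarrow> U \<subseteq> \<Omega> \<longrightarrow> (\<exists>v\<in>\<Omega>. \<forall>u\<in>U. (v, u) \<in> r))"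

definition upward_directed :: "'b set \<Rightarrow> 'b rel \<Rightarrow> bool" where
  "upward_directed \<Omega> r \<longleftrightarrow> downward_directed \<Omega> (r\<inverse>)"

definition downward_cofinal ::
  "'c set \<Rightarrow> 'c rel \<Rightarrow> 'b set \<Rightarrow> 'b rel \<Rightarrow> ('c \<Rightarrow> 'b) \<Rightarrow> bool" where
  "downward_cofinal \<Omega>' r' \<Omega> r \<gamma> \<longleftrightarrow>
     \<gamma> \<in> \<Omega>' \<rightarrow> \<Omega> \<and> (\<forall>u\<in>\<Omega>. \<exists>v\<in>\<Omega>'. \<forall>w\<in>\<Omega>'. (w, v) \<in> r' \<longrightarrow> (\<gamma> w, u) \<in> r)"

(* Only the order on the codomain is reversed: the domain is still followed downward. *)
definition upward_cofinal ::
  "'c set \<Rightarrow> 'c rel \<Rightarrow> 'b set \<Rightarrow> 'b rel \<Rightarrow> ('c \<Rightarrow> 'b) \<Rightarrow> bool" where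
  "upward_cofinal \<Omega>' r' \<Omega> r \<gamma> \<longleftrightarrow>
     \<gamma> \<in> \<Omega>' \<rightarrow> \<Omega> \<and> (\<forall>u\<in>\<Omega>. \<exists>v\<in>\<Omega>'. \<forall>w\<in>\<Omega>'. (w, v) \<in> r' \<longrightarrow> (u, \<gamma> w) \<in> r)"

definition pos_pairs :: "('a::{zero, ord} \<times> 'a) set" where
  "pos_pairs = {0<..} \<times> {0<..}"

definition pos_pairs_rel :: "('a::{zero, ord} \<times> 'a) rel" where
  "pos_pairs_rel =
     {((s, t), (s', t')) | s t s' t'.
        (s, t) \<in> pos_pairs \<and> (s', t') \<in> pos_pairs \<and> s \<le> s' \<and> t \<ge> t'}"

(* A map from the positive quadrant to R^n is definable if its graph is. *)
definition definable_on_pos_pairs ::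
  "('a::{zero, plus, ord}, 'f, 'r) expansion \<Rightarrow> nat \<Rightarrow> ('a \<times> 'a \<Rightarrow> 'a list) \<Rightarrow> bool" where
  "definable_on_pos_pairs M n \<gamma> \<longleftrightarrow>
     definable M (2 + n) {[s, t] @ \<gamma> (s, t) | s t. (s, t) \<in> pos_pairs}"

end

theory Submission
  imports Defs
begin

text \<open>Let \<open>\<Omega> \<subseteq> R\<^sup>n\<close> be downward directed. It suffices to find a definable family of sets
  \<open>K s t\<close>, increasing as \<open>s\<close> decreases and \<open>t\<close> increases, with union \<open>R\<^sup>n\<close>, such that each
  \<open>\<Omega> \<inter> K s t\<close> has a lower bound in \<open>\<Omega>\<close>: a definable choice of such lower bounds is cofinal.

  For \<open>n = 1\<close>, call \<open>u\<close> exceptional if no neighbourhood of \<open>u\<close> has a common lower bound. There are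
  only finitely many exceptional points: otherwise they would fill an interval, every up-set
  of a \<open>v \<in> \<Omega>\<close> would meet this interval in a finite set, and by directedness these finite sets,
  which depend on finitely many parameters, would cover all finite subsets of the interval. Now let
  \<open>K s t\<close> consist of the \<open>y\<close> with \<open>\<bar>y\<bar> \<le> t\<close> that are not in a punctured \<open>s\<close>-neighbourhood of an
  exceptional point; a supremum argument bounds it from below. This construction is uniform in
  parameters, so the general case follows by induction on the number of coordinates, provided the
  covers by up-sets are allowed to shrink with the scales \<open>s\<close> and \<open>t\<close>.\<close>

section \<open>Definability calculus\<close>

text \<open>Definability of predicates, terms and lists depending on an assignment \<open>e\<close> of all
  variables. An \<open>n\<close>-ary relation is a predicate on lists, of which only the values on lists of
  length \<open>n\<close> matter.\<close>

definition dpred :: "('a::{plus, ord}, 'f, 'r) expansion \<Rightarrow> ((nat \<Rightarrow> 'a) \<Rightarrow> bool) \<Rightarrow> bool" where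
  "dpred M P \<longleftrightarrow> (\<exists>\<phi>. \<forall>e. sat M e \<phi> = P e)"

definition dterm :: "('a::plus, 'f, 'r) expansion \<Rightarrow> ((nat \<Rightarrow> 'a) \<Rightarrow> 'a) \<Rightarrow> bool" where
  "dterm M t \<longleftrightarrow> (\<exists>\<tau>. \<forall>e. term_val M e \<tau> = t e)"

definition dlist :: "('a::plus, 'f, 'r) expansion \<Rightarrow> ((nat \<Rightarrow> 'a) \<Rightarrow> 'a list) \<Rightarrow> bool" where
  "dlist M xs \<longleftrightarrow> (\<exists>\<tau>s. \<forall>e. map (term_val M e) \<tau>s = xs e)"

definition drel :: "('a::{plus, ord}, 'f, 'r) expansion \<Rightarrow> nat \<Rightarrow> ('a list \<Rightarrow> bool) \<Rightarrow> bool" where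
  "drel M k X \<longleftrightarrow> dpred M (\<lambda>e. X (map e [0..<k]))"

section \<open>Substitution, and the dependence of values on finitely many variables\<close>

primrec term_subst :: "(nat \<Rightarrow> ('a, 'f) fo_term) \<Rightarrow> ('a, 'f) fo_term \<Rightarrow> ('a, 'f) fo_term" where
  "term_subst \<tau> (Var i) = \<tau> i"
| "term_subst \<tau> (Const a) = Const a"
| "term_subst \<tau> (Plus s t) = Plus (term_subst \<tau> s) (term_subst \<tau> t)"
| "term_subst \<tau> (Fun f ts) = Fun f (map (term_subst \<tau>) ts)"

lemma term_val_subst:
  "term_val M e (term_subst \<tau> t) = term_val M (\<lambda>i. term_val M e (\<tau> i)) t"
  by (induction t) (auto simp: comp_def cong: map_cong)

text \<open>Any number above all variable indices that occur will do, so sums stand in for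
  maxima.\<close>

primrec term_bound :: "('a, 'f) fo_term \<Rightarrow> nat" where
  "term_bound (Var i) = Suc i"
| "term_bound (Const a) = 0"
| "term_bound (Plus s t) = term_bound s + term_bound t"
| "term_bound (Fun f ts) = sum_list (map term_bound ts)"

lemma term_val_cong:
  "(\<And>i. i < term_bound t \<Longrightarrow> e i = e' i) \<Longrightarrow> term_val M e t = term_val M e' t"
proof (induction t)
  case (Fun f ts)
  have "map (term_val M e) ts = map (term_val M e') ts"
  proof (intro map_cong refl Fun.IH)
    fix t i assume "t \<in> set ts" "i < term_bound t"
    then have "i < sum_list (map term_bound ts)"
      using member_le_sum_list[of "term_bound t" "map term_bound ts"] by force
    then show "e i = e' i" using Fun.prems by simp
  qed
  then show ?case by (simp only: term_val.simps)
next
  case (Plus s t)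
  show ?case using Plus.IH Plus.prems by simp
qed simp_all

primrec formula_bound :: "('a, 'f, 'r) fo_formula \<Rightarrow> nat" where
  "formula_bound (Eq s t) = term_bound s + term_bound t"
| "formula_bound (Less s t) = term_bound s + term_bound t"
| "formula_bound (Rel r ts) = sum_list (map term_bound ts)"
| "formula_bound (Neg \<phi>) = formula_bound \<phi>"
| "formula_bound (Conj \<phi> \<psi>) = formula_bound \<phi> + formula_bound \<psi>"
| "formula_bound (Exists i \<phi>) = formula_bound \<phi>"

lemma sat_cong:
  "(\<And>i. i < formula_bound \<phi> \<Longrightarrow> e i = e' i) \<Longrightarrow> sat M e \<phi> = sat M e' \<phi>"
proof (induction \<phi> arbitrary: e e')
  case (Eq s t)
  then show ?case
    using term_val_cong[of s e e' M] term_val_cong[of t e e' M] by simp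
next
  case (Less s t)
  then show ?case
    using term_val_cong[of s e e' M] term_val_cong[of t e e' M] by simp
next
  case (Rel r ts)
  have "map (term_val M e) ts = map (term_val M e') ts"
  proof (intro map_cong refl term_val_cong)
    fix t i assume "t \<in> set ts" "i < term_bound t"
    then have "i < sum_list (map term_bound ts)"
      using member_le_sum_list[of "term_bound t" "map term_bound ts"] by force
    then show "e i = e' i" using Rel by simp
  qed
  then show ?case by (simp only: sat.simps)
next
  case (Neg \<phi>)
  show ?case using Neg.IH[of e e'] Neg.prems by simp
next
  case (Conj \<phi> \<psi>)
  show ?case using Conj.IH(1)[of e e'] Conj.IH(2)[of e e'] Conj.prems by simp
next
  case (Exists j \<phi>)
  have "sat M (e(j := a)) \<phi> = sat M (e'(j := a)) \<phi>" for a
    using Exists.prems by (intro Exists.IH) simp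
  then show ?case by simp
qed

text \<open>Bound variables are renamed during the induction to avoid capture. Only the existence of
  a suitable formula is claimed, so no explicit substitution function on formulas has to be
  fixed.\<close>

lemma sat_subst:
  "\<exists>\<psi>. \<forall>e. sat M e \<psi> = sat M (\<lambda>i. term_val M e (\<tau> i)) \<phi>"
proof (induction \<phi> arbitrary: \<tau>)
  case (Eq s t)
  show ?case by (intro exI[of _ "Eq (term_subst \<tau> s) (term_subst \<tau> t)"]) (simp add: term_val_subst)
next
  case (Less s t)
  show ?case by (intro exI[of _ "Less (term_subst \<tau> s) (term_subst \<tau> t)"]) (simp add: term_val_subst)
next
  case (Rel r ts)
  show ?case
    by (intro exI[of _ "Rel r (map (term_subst \<tau>) ts)"]) (simp add: term_val_subst comp_def)
next
  case (Neg \<phi>)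
  then obtain \<psi> where "\<forall>e. sat M e \<psi> = sat M (\<lambda>i. term_val M e (\<tau> i)) \<phi>" by blast
  then show ?case by (intro exI[of _ "Neg \<psi>"]) simp
next
  case (Conj \<phi> \<phi>')
  then obtain \<psi> \<psi>' where "\<forall>e. sat M e \<psi> = sat M (\<lambda>i. term_val M e (\<tau> i)) \<phi>"
    "\<forall>e. sat M e \<psi>' = sat M (\<lambda>i. term_val M e (\<tau> i)) \<phi>'" by metis
  then show ?case by (intro exI[of _ "Conj \<psi> \<psi>'"]) simp
next
  case (Exists j \<phi>)
  \<comment> \<open>The bound variable is renamed to \<open>l\<close>, which is fresh for every
    \<open>\<tau> i\<close> with \<open>i\<close> below \<open>formula_bound \<phi>\<close>.\<close>
  define l where "l = sum_list (map (\<lambda>i. term_bound (\<tau> i)) [0..<formula_bound \<phi>])"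
  obtain \<psi> where \<psi>: "\<forall>e. sat M e \<psi> = sat M (\<lambda>i. term_val M e ((\<tau>(j := Var l)) i)) \<phi>"
    using Exists by blast
  have "sat M (e(l := a)) \<psi> = sat M ((\<lambda>i. term_val M e (\<tau> i))(j := a)) \<phi>" for e a
    unfolding \<psi>[rule_format]
  proof (rule sat_cong)
    fix i assume "i < formula_bound \<phi>"
    then have "term_bound (\<tau> i) \<le> l"
      unfolding l_def by (intro member_le_sum_list) auto
    then have "term_val M (e(l := a)) (\<tau> i) = term_val M e (\<tau> i)"
      by (intro term_val_cong) simp
    then show "term_val M (e(l := a)) ((\<tau>(j := Var l)) i) = ((\<lambda>i. term_val M e (\<tau> i))(j := a)) i"
      by simp
  qed
  then show ?case by (intro exI[of _ "Exists l \<psi>"]) simp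
qed

section \<open>Closure properties of definable terms, lists and predicates\<close>

lemma dtermI: "(\<And>e. term_val M e \<tau> = t e) \<Longrightarrow> dterm M t"
  unfolding dterm_def by blast

lemma dlistI: "(\<And>e. map (term_val M e) \<tau>s = xs e) \<Longrightarrow> dlist M xs"
  unfolding dlist_def by blast

lemma dpredI: "(\<And>e. sat M e \<phi> = P e) \<Longrightarrow> dpred M P"
  unfolding dpred_def by blast

lemma dpred_subst:
  assumes "dpred M P" and "\<And>i. dterm M (t i)"
  shows "dpred M (\<lambda>e. P (\<lambda>i. t i e))"
proof -
  obtain \<phi> where \<phi>: "\<forall>e. sat M e \<phi> = P e" using assms(1) unfolding dpred_def by (rule exE)
  have "\<forall>i. \<exists>\<tau>. \<forall>e. term_val M e \<tau> = t i e"
    using assms(2) unfolding dterm_def by blast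
  then obtain \<tau> where \<tau>: "\<forall>i. \<forall>e. term_val M e (\<tau> i) = t i e"
    by (rule choice[THEN exE])
  obtain \<psi> where "\<forall>e. sat M e \<psi> = sat M (\<lambda>i. term_val M e (\<tau> i)) \<phi>"
    using sat_subst[of M \<tau> \<phi>] by (rule exE)
  then show ?thesis by (intro dpredI[of M \<psi>]) (simp add: \<phi> \<tau>)
qed

lemma dterm_var: "dterm M (\<lambda>e. e i)"
  by (rule dtermI[of M "Var i"]) simp

lemma dterm_const: "dterm M (\<lambda>e. c)"
  by (rule dtermI[of M "Const c"]) simp

lemma dterm_plus:
  assumes "dterm M s" and "dterm M t"
  shows "dterm M (\<lambda>e. s e + t e)"
proof -
  obtain \<sigma> \<tau> where "\<forall>e. term_val M e \<sigma> = s e" and "\<forall>e. term_val M e \<tau> = t e"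
    using assms unfolding dterm_def by blast
  then show ?thesis by (intro dtermI[of M "Plus \<sigma> \<tau>"]) simp
qed

lemma dlist_const: "dlist M (\<lambda>e. xs)"
  by (rule dlistI[of M "map Const xs"]) (simp add: comp_def)

lemma dlist_map: "dlist M (\<lambda>e. map (\<lambda>i. e (f i)) is)"
  by (rule dlistI[of M "map (\<lambda>i. Var (f i)) is"]) (simp add: comp_def)

lemma dlist_Cons:
  assumes "dterm M t" and "dlist M xs"
  shows "dlist M (\<lambda>e. t e # xs e)"
proof -
  obtain \<tau> \<tau>s where "\<forall>e. term_val M e \<tau> = t e" and "\<forall>e. map (term_val M e) \<tau>s = xs e"
    using assms unfolding dterm_def dlist_def by blast
  then show ?thesis by (intro dlistI[of M "\<tau> # \<tau>s"]) simp
qed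

lemma dlist_append:
  assumes "dlist M xs" and "dlist M ys"
  shows "dlist M (\<lambda>e. xs e @ ys e)"
proof -
  obtain \<sigma>s \<tau>s where "\<forall>e. map (term_val M e) \<sigma>s = xs e" and "\<forall>e. map (term_val M e) \<tau>s = ys e"
    using assms unfolding dlist_def by blast
  then show ?thesis by (intro dlistI[of M "\<sigma>s @ \<tau>s"]) simp
qed

lemma dpred_eq:
  assumes "dterm M s" and "dterm M t"
  shows "dpred M (\<lambda>e. s e = t e)"
proof -
  obtain \<sigma> \<tau> where "\<forall>e. term_val M e \<sigma> = s e" and "\<forall>e. term_val M e \<tau> = t e"
    using assms unfolding dterm_def by blast
  then show ?thesis by (intro dpredI[of M "Eq \<sigma> \<tau>"]) simp
qed

lemma dpred_less:
  assumes "dterm M s" and "dterm M t"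
  shows "dpred M (\<lambda>e. s e < t e)"
proof -
  obtain \<sigma> \<tau> where "\<forall>e. term_val M e \<sigma> = s e" and "\<forall>e. term_val M e \<tau> = t e"
    using assms unfolding dterm_def by blast
  then show ?thesis by (intro dpredI[of M "Less \<sigma> \<tau>"]) simp
qed

lemma dpred_not:
  assumes "dpred M P"
  shows "dpred M (\<lambda>e. \<not> P e)"
proof -
  obtain \<phi> where "\<forall>e. sat M e \<phi> = P e" using assms unfolding dpred_def by blast
  then show ?thesis by (intro dpredI[of M "Neg \<phi>"]) simp
qed

lemma dpred_conj:
  assumes "dpred M P" and "dpred M Q"
  shows "dpred M (\<lambda>e. P e \<and> Q e)"
proof -
  obtain \<phi> \<psi> where "\<forall>e. sat M e \<phi> = P e" and "\<forall>e. sat M e \<psi> = Q e"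
    using assms unfolding dpred_def by blast
  then show ?thesis by (intro dpredI[of M "Conj \<phi> \<psi>"]) simp
qed

lemma dpred_disj: "dpred M P \<Longrightarrow> dpred M Q \<Longrightarrow> dpred M (\<lambda>e. P e \<or> Q e)"
  using dpred_not[of M "\<lambda>e. \<not> P e \<and> \<not> Q e"] dpred_conj[of M "\<lambda>e. \<not> P e" "\<lambda>e. \<not> Q e"]
    dpred_not[of M P] dpred_not[of M Q] by simp

lemma dpred_imp: "dpred M P \<Longrightarrow> dpred M Q \<Longrightarrow> dpred M (\<lambda>e. P e \<longrightarrow> Q e)"
  using dpred_disj[of M "\<lambda>e. \<not> P e" Q] dpred_not[of M P] by simp

lemma dpred_le:
  fixes M :: "('a::{plus, linorder}, 'f, 'r) expansion"
  shows "dterm M s \<Longrightarrow> dterm M t \<Longrightarrow> dpred M (\<lambda>e. s e \<le> t e)"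
  using dpred_not[of M "\<lambda>e. t e < s e"] dpred_less[of M t s] by (simp add: not_less)

lemma dpred_False: "dpred M (\<lambda>e. False)"
  using dpred_not[OF dpred_eq[OF dterm_var[of M 0] dterm_var[of M 0]]] by simp

lemma dpred_Bex:
  assumes "finite A" and "\<And>a. a \<in> A \<Longrightarrow> dpred M (P a)"
  shows "dpred M (\<lambda>e. \<exists>a\<in>A. P a e)"
  using assms by (induction A rule: finite_induct) (auto intro: dpred_False dpred_disj)

text \<open>Quantifiers bind variable 0 and shift the remaining variables, in the style of de Bruijn.\<close>

lemma dpred_ex:
  assumes "dpred M (\<lambda>e. Q (\<lambda>i. e (Suc i)) (e 0))"
  shows "dpred M (\<lambda>e. \<exists>a. Q e a)"
proof -
  obtain \<phi> where \<phi>: "\<forall>e. sat M e \<phi> = Q (\<lambda>i. e (Suc i)) (e 0)"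
    using assms unfolding dpred_def by blast
  \<comment> \<open>Undoing the shift sends variable 0 to \<open>N\<close> and \<open>Suc i\<close>
    to \<open>i\<close>. These do not clash, since \<open>Suc i < N\<close> for the variables that
    matter.\<close>
  define N where "N = formula_bound \<phi>"
  obtain \<psi> where \<psi>: "\<forall>e. sat M e \<psi> = sat M (\<lambda>i. term_val M e (Var (case i of 0 \<Rightarrow> N | Suc i \<Rightarrow> i))) \<phi>"
    using sat_subst[of M "\<lambda>i. Var (case i of 0 \<Rightarrow> N | Suc i \<Rightarrow> i)" \<phi>] by (rule exE)
  have "sat M (e(N := a)) \<psi> = sat M (case_nat a e) \<phi>" for e a
    unfolding \<psi>[rule_format] by (intro sat_cong) (auto simp: N_def split: nat.splits)
  then have "sat M e (Exists N \<psi>) = (\<exists>a. Q e a)" for e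
    by (simp add: \<phi>)
  then show ?thesis by (rule dpredI)
qed

lemma dpred_all:
  assumes "dpred M (\<lambda>e. Q (\<lambda>i. e (Suc i)) (e 0))"
  shows "dpred M (\<lambda>e. \<forall>a. Q e a)"
  using dpred_not[OF dpred_ex[of M "\<lambda>e a. \<not> Q e a", OF dpred_not[OF assms]]] by simp

lemma dpred_ex_list:
  fixes M :: "('a::{plus, ord}, 'f, 'r) expansion"
  assumes "dpred M (\<lambda>e. Q (\<lambda>i. e (i + k)) (map (\<lambda>i. e i) [0..<k]))"
  shows "dpred M (\<lambda>e. \<exists>v. length v = k \<and> Q e v)"
  using assms
proof (induction k arbitrary: Q)
  case 0
  then show ?case by simp
next
  case (Suc k)
  \<comment> \<open>A cyclic permutation of the first \<open>k + 1\<close> variables: it moves the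
    last list entry to variable 0, where \<open>dpred_ex\<close> binds it.\<close>
  define f where "f i = (if i < k then Suc i else if i = k then 0 else i)" for i
  have "dpred M (\<lambda>e. Q (\<lambda>i. e (f (i + Suc k))) (map (\<lambda>i. e (f i)) [0..<Suc k]))"
    by (rule dpred_subst[OF Suc.prems dterm_var])
  moreover have "(\<lambda>i. e (f (i + Suc k))) = (\<lambda>i. e (Suc (i + k)))"
    and "map (\<lambda>i. e (f i)) [0..<Suc k] = map (\<lambda>i. e (Suc i)) [0..<k] @ [e 0]" for e :: "nat \<Rightarrow> 'a"
    by (auto simp: f_def)
  ultimately have "dpred M (\<lambda>e. Q (\<lambda>i. e (Suc (i + k))) (map (\<lambda>i. e (Suc i)) [0..<k] @ [e 0]))"
    by (simp only:)
  then have "dpred M (\<lambda>e. \<exists>v. length v = k \<and> (\<exists>a. Q e (v @ [a])))"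
    by (intro Suc.IH dpred_ex)
  moreover have "(\<exists>v. length v = k \<and> (\<exists>a. Q e (v @ [a]))) \<longleftrightarrow> (\<exists>v. length v = Suc k \<and> Q e v)" for e
    by (metis length_append_singleton length_Suc_conv_rev)
  ultimately show ?case by simp
qed

lemma dpred_all_list:
  assumes "dpred M (\<lambda>e. Q (\<lambda>i. e (i + k)) (map (\<lambda>i. e i) [0..<k]))"
  shows "dpred M (\<lambda>e. \<forall>v. length v = k \<longrightarrow> Q e v)"
  using dpred_not[OF dpred_ex_list[of M "\<lambda>e v. \<not> Q e v", OF dpred_not[OF assms]]] by simp

text \<open>Terms are substituted for the canonical variables \<open>0..<k\<close>, which evaluates
  a definable relation at arbitrary lists of terms.\<close>

lemma drelD:
  assumes "drel M k X" and "dlist M xs" and "\<And>e. length (xs e) = k"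
  shows "dpred M (\<lambda>e. X (xs e))"
proof -
  obtain \<tau>s where \<tau>s: "\<forall>e. map (term_val M e) \<tau>s = xs e"
    using assms(2) unfolding dlist_def by blast
  have len: "length \<tau>s = k" using assms(3) \<tau>s by (metis length_map)
  have "dpred M (\<lambda>e. X (map (\<lambda>i. term_val M e (\<tau>s ! i)) [0..<k]))"
    using dpred_subst[OF assms(1)[unfolded drel_def], of "\<lambda>i e. term_val M e (\<tau>s ! i)"]
    by (auto simp: dterm_def)
  moreover have "map (\<lambda>i. term_val M e (\<tau>s ! i)) [0..<k] = xs e" for e
    unfolding \<tau>s[rule_format, symmetric] len[symmetric] by (rule nth_equalityI) auto
  ultimately show ?thesis by simp
qed

lemma drel_SucI:
  assumes "dpred M (\<lambda>e. X (e 0 # map (\<lambda>i. e (Suc i)) [0..<k]))"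
  shows "drel M (Suc k) X"
proof -
  have "map e [0..<Suc k] = e 0 # map (\<lambda>i. e (Suc i)) [0..<k]" for e :: "nat \<Rightarrow> 'a"
    by (simp add: upt_rec[of 0 "Suc k"] map_Suc_upt[symmetric] comp_def del: upt_Suc)
  then show ?thesis using assms unfolding drel_def by simp
qed

lemma drel_appendI:
  assumes "dpred M (\<lambda>e. X (map (\<lambda>i. e i) [0..<j] @ map (\<lambda>i. e (i + j)) [0..<k]))"
  shows "drel M (j + k) X"
proof -
  have "map e [0..<j + k] = map e [0..<j] @ map (\<lambda>i. e (i + j)) [0..<k]" for e :: "nat \<Rightarrow> 'a"
    by (rule nth_equalityI) (auto simp: nth_append)
  then show ?thesis using assms unfolding drel_def by simp
qed

lemmas dintros = dpred_not dpred_conj dpred_disj dpred_imp dpred_eq dpred_less dpred_le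
  dpred_all_list dpred_ex_list dpred_ex dpred_all dterm_var dterm_const dterm_plus
  dlist_const dlist_map dlist_Cons dlist_append

lemma drel_definable:
  fixes M :: "('a::{zero, plus, ord}, 'f, 'r) expansion"
  assumes "definable M n X"
  shows "drel M n (\<lambda>x. x \<in> X)" and "x \<in> X \<Longrightarrow> length x = n"
proof -
  obtain \<phi> where X: "X = {xs. length xs = n \<and> sat M (nth_default 0 xs) \<phi>}"
    using assms unfolding definable_def by blast
  show "x \<in> X \<Longrightarrow> length x = n" by (simp add: X)
  have "dpred M (\<lambda>e. sat M e \<phi>)" unfolding dpred_def by blast
  \<comment> \<open>\<open>definable\<close> evaluates the variables from \<open>n\<close> on to 0,
    so the constant 0 is substituted for them.\<close>
  moreover have "dterm M (\<lambda>e. if i < n then e i else 0)" for i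
    by (cases "i < n") (simp_all add: dterm_var dterm_const)
  ultimately have "dpred M (\<lambda>e. sat M (\<lambda>i. if i < n then e i else 0) \<phi>)"
    by (rule dpred_subst)
  moreover have "(\<lambda>i. if i < n then e i else 0) = nth_default 0 (map e [0..<n])" for e :: "nat \<Rightarrow> 'a"
    by (auto simp: nth_default_def)
  ultimately show "drel M n (\<lambda>x. x \<in> X)" unfolding drel_def X by simp
qed

lemma definableI:
  fixes M :: "('a::{zero, plus, ord}, 'f, 'r) expansion"
  assumes "dpred M P"
  shows "definable M n {xs. length xs = n \<and> P (nth_default 0 xs)}"
  using assms unfolding definable_def dpred_def by auto

section \<open>O-minimality in one variable\<close>

context linordered_group_add
begin

lemma group_add_less_cancel_left: "c + a < c + b \<longleftrightarrow> a < b"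
  using group_add_strict_left_mono[of a b c] group_add_strict_left_mono[of b a c]
  by (metis less_asym less_linear)

lemma group_add_less_cancel_right: "a + c < b + c \<longleftrightarrow> a < b"
  using group_add_strict_right_mono[of a b c] group_add_strict_right_mono[of b a c]
  by (metis less_asym less_linear)

lemma group_add_le_cancel_left: "c + a \<le> c + b \<longleftrightarrow> a \<le> b"
  using group_add_less_cancel_left[of c b a] by (simp only: not_less[symmetric])

lemma group_add_le_cancel_right: "a + c \<le> b + c \<longleftrightarrow> a \<le> b"
  using group_add_less_cancel_right[of b c a] by (simp only: not_less[symmetric])

end

lemmas group_add_order = group_add_less_cancel_left group_add_less_cancel_right
  group_add_le_cancel_left group_add_le_cancel_right

lemma less_add_pos:
  fixes a c :: "'a::linordered_group_add"
  shows "0 < c \<Longrightarrow> a < a + c"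
  using group_add_less_cancel_left[of a 0 c] by simp

text \<open>A relation rather than an operator: it unfolds to a first-order condition and
  presupposes no completeness of the order.\<close>

definition is_sup :: "('a::linorder \<Rightarrow> bool) \<Rightarrow> 'a \<Rightarrow> bool" where
  "is_sup P c \<longleftrightarrow> (\<forall>x. P x \<longrightarrow> x \<le> c) \<and> (\<forall>d. (\<forall>x. P x \<longrightarrow> x \<le> d) \<longrightarrow> c \<le> d)"

definition is_inf :: "('a::linorder \<Rightarrow> bool) \<Rightarrow> 'a \<Rightarrow> bool" where
  "is_inf P c \<longleftrightarrow> (\<forall>x. P x \<longrightarrow> c \<le> x) \<and> (\<forall>d. (\<forall>x. P x \<longrightarrow> d \<le> x) \<longrightarrow> d \<le> c)"

lemma is_supI:
  assumes "\<And>x. P x \<Longrightarrow> x \<le> c" and "\<And>d. d < c \<Longrightarrow> \<exists>x. P x \<and> d < x"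
  shows "is_sup P c"
  using assms unfolding is_sup_def by (meson leD leI)

lemma is_sup_upper: "is_sup P c \<Longrightarrow> P x \<Longrightarrow> x \<le> c"
  unfolding is_sup_def by blast

lemma is_sup_approx: "is_sup P c \<Longrightarrow> d < c \<Longrightarrow> \<exists>x. P x \<and> d < x"
  unfolding is_sup_def by (meson leD leI)

lemma is_inf_lower: "is_inf P c \<Longrightarrow> P x \<Longrightarrow> c \<le> x"
  unfolding is_inf_def by blast

lemma is_inf_approx: "is_inf P c \<Longrightarrow> c < d \<Longrightarrow> \<exists>x. P x \<and> x < d"
  unfolding is_inf_def by (meson leD leI)

lemma is_sup_unique: "is_sup P c \<Longrightarrow> is_sup P d \<Longrightarrow> c = d"
  unfolding is_sup_def by (meson order_antisym)

lemma is_inf_unique: "is_inf P c \<Longrightarrow> is_inf P d \<Longrightarrow> c = d"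
  unfolding is_inf_def by (meson order_antisym)

lemma is_inf_lower_bounds: "is_sup (\<lambda>c. \<forall>x. P x \<longrightarrow> c \<le> x) c \<Longrightarrow> is_inf P c"
  unfolding is_sup_def is_inf_def by blast

lemma ex_is_sup_interval:
  fixes A :: "'a::unbounded_dense_linorder set"
  assumes "A \<in> points_and_intervals" and "A \<noteq> {}" and "\<And>x. x \<in> A \<Longrightarrow> x \<le> b"
  shows "\<exists>c. is_sup (\<lambda>x. x \<in> A) c"
proof -
  consider a where "A = {a}" | a c where "A = {a<..<c}" | a where "A = {a<..}"
    | c where "A = {..<c}" | "A = UNIV"
    using assms(1) unfolding points_and_intervals_def by blast
  then show ?thesis
  proof cases
    case 1
    then show ?thesis by (auto simp: is_sup_def)
  next
    case (2 a c)
    then have "a < c" using assms(2) by auto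
    have "is_sup (\<lambda>x. x \<in> A) c"
    proof (rule is_supI)
      fix d assume "d < c"
      then have "max a d < c" using \<open>a < c\<close> by simp
      then obtain x where "max a d < x" "x < c" using dense by blast
      then show "\<exists>x. x \<in> A \<and> d < x" using 2 by auto
    qed (use 2 in auto)
    then show ?thesis ..
  next
    case (3 a)
    obtain x where "max a b < x" using gt_ex by blast
    then show ?thesis using assms(3)[of x] 3 by auto
  next
    case (4 c)
    have "is_sup (\<lambda>x. x \<in> A) c"
    proof (rule is_supI)
      fix d assume "d < c"
      then obtain x where "d < x" "x < c" using dense by blast
      then show "\<exists>x. x \<in> A \<and> d < x" using 4 by auto
    qed (use 4 in auto)
    then show ?thesis ..
  next
    case 5
    obtain x where "b < x" using gt_ex by blast
    then show ?thesis using assms(3)[of x] 5 by auto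
  qed
qed

lemma ex_is_sup_Union:
  fixes F :: "'a::unbounded_dense_linorder set set"
  assumes "finite F" and "F \<subseteq> points_and_intervals" and "\<Union>F \<noteq> {}"
    and "\<And>x. x \<in> \<Union>F \<Longrightarrow> x \<le> b"
  shows "\<exists>c. is_sup (\<lambda>x. x \<in> \<Union>F) c"
  using assms
proof (induction F rule: finite_induct)
  case (insert A F)
  \<comment> \<open>Empty members, such as \<open>{a<..<b}\<close> with \<open>b \<le> a\<close>,
    have no supremum and are split off.\<close>
  consider "A = {}" | "\<Union>F = {}" "A \<noteq> {}" | "A \<noteq> {}" "\<Union>F \<noteq> {}" by blast
  then show ?case
  proof cases
    case 1
    then show ?thesis using insert by simp
  next
    case 2
    then have "\<Union>(insert A F) = A" by auto
    moreover have "\<exists>c. is_sup (\<lambda>x. x \<in> A) c"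
      using ex_is_sup_interval[of A b] insert.prems 2 by simp
    ultimately show ?thesis by (simp only:)
  next
    case 3
    obtain c where c: "is_sup (\<lambda>x. x \<in> A) c"
      using ex_is_sup_interval[of A b] insert.prems 3 by blast
    obtain d where d: "is_sup (\<lambda>x. x \<in> \<Union>F) d"
      using insert 3 by auto
    have "is_sup (\<lambda>x. x \<in> \<Union>(insert A F)) (max c d)"
    proof (rule is_supI)
      fix x assume "x \<in> \<Union>(insert A F)"
      then show "x \<le> max c d"
        using is_sup_upper[OF c, of x] is_sup_upper[OF d, of x] by (auto simp: le_max_iff_disj)
    next
      fix z assume "z < max c d"
      then show "\<exists>x. x \<in> \<Union>(insert A F) \<and> z < x"
        using is_sup_approx[OF c, of z] is_sup_approx[OF d, of z] by (auto simp: less_max_iff_disj)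
    qed
    then show ?thesis ..
  qed
qed simp

lemma dpred_app:
  assumes "dpred M (\<lambda>e. P (e 0))" and "dterm M t"
  shows "dpred M (\<lambda>e. P (t e))"
  using dpred_subst[OF assms(1), of "\<lambda>_. t"] assms(2) by simp

lemma dpred_app2:
  assumes "dpred M (\<lambda>e. P (e 0) (e (Suc 0)))" and "dterm M s" and "dterm M t"
  shows "dpred M (\<lambda>e. P (s e) (t e))"
  using dpred_subst[OF assms(1), of "\<lambda>i. if i = 0 then s else t"] assms(2,3) by simp

section \<open>Definable subsets of the line: finiteness and completeness\<close>

locale o_minimal_expansion =
  fixes M :: "('a::{linordered_group_add, unbounded_dense_linorder}, 'f, 'r) expansion"
  assumes o_minimal: "o_minimal M"
begin

lemma finite_union_of_intervals:
  assumes "dpred M (\<lambda>e. P (e 0))"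
  obtains F where "finite F" and "F \<subseteq> points_and_intervals" and "{x. P x} = \<Union>F"
proof -
  let ?X = "{xs. length xs = 1 \<and> P (nth_default 0 xs 0)}"
  have "definable M 1 ?X" by (rule definableI[OF assms])
  moreover have "{x. [x] \<in> ?X} = {x. P x}" by simp
  ultimately show ?thesis using o_minimal that unfolding o_minimal_def by metis
qed

lemma infinite_imp_interval:
  assumes "dpred M (\<lambda>e. P (e 0))" and "infinite {x. P x}"
  shows "\<exists>a b. a < b \<and> (\<forall>x. a < x \<and> x < b \<longrightarrow> P x)"
proof -
  obtain F where F: "finite F" "F \<subseteq> points_and_intervals" "{x. P x} = \<Union>F"
    using finite_union_of_intervals[OF assms(1)] .
  then obtain A where A: "A \<in> F" "infinite A" using assms(2) by (metis finite_Union)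
  have P: "P x" if "x \<in> A" for x using A(1) F(3) that by blast
  have "A \<in> points_and_intervals" using A F by blast
  then consider a where "A = {a}" | a c where "A = {a<..<c}" | a where "A = {a<..}"
    | c where "A = {..<c}" | "A = UNIV"
    unfolding points_and_intervals_def by blast
  then show ?thesis
  proof cases
    case 1
    then show ?thesis using A by simp
  next
    case (2 a c)
    then have "a < c" using A(2) by (metis finite.emptyI greaterThanLessThan_empty leI)
    then show ?thesis using P 2 by auto
  next
    case (3 a)
    obtain b where "a < b" using gt_ex by blast
    then show ?thesis using P 3 by auto
  next
    case (4 c)
    obtain b where "b < c" using lt_ex by blast
    then show ?thesis using P 4 by auto
  next
    case 5
    obtain b c :: 'a where "b < c" using lt_ex by blast
    then show ?thesis using P 5 by auto
  qed
qed

lemma interval_imp_infinite: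
  fixes a b :: 'a
  assumes "a < b" and "\<And>x. a < x \<Longrightarrow> x < b \<Longrightarrow> P x"
  shows "infinite {x. P x}"
proof -
  have "{a<..<b} \<subseteq> {x. P x}" using assms(2) by auto
  then show ?thesis using infinite_Ioo[OF assms(1)] finite_subset by blast
qed

text \<open>The right side is first-order, so having infinite fibers is a definable condition on the
  parameters.\<close>

lemma infinite_iff_interval:
  assumes "dpred M (\<lambda>e. P (e 0))"
  shows "infinite {x. P x} \<longleftrightarrow> (\<exists>a b. a < b \<and> (\<forall>x. a < x \<and> x < b \<longrightarrow> P x))"
  using infinite_imp_interval[OF assms] interval_imp_infinite[of _ _ P] by blast

lemma ex_is_sup:
  assumes "dpred M (\<lambda>e. P (e 0))" and "P x" and "\<And>x. P x \<Longrightarrow> x \<le> b"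
  shows "\<exists>c. is_sup P c"
proof -
  obtain F where F: "finite F" "F \<subseteq> points_and_intervals" "{x. P x} = \<Union>F"
    using finite_union_of_intervals[OF assms(1)] .
  have "\<Union>F \<noteq> {}" and "\<And>x. x \<in> \<Union>F \<Longrightarrow> x \<le> b" using assms(2,3) F(3) by blast+
  then obtain c where "is_sup (\<lambda>x. x \<in> \<Union>F) c" using ex_is_sup_Union F(1,2) by blast
  then show ?thesis unfolding F(3)[symmetric] by auto
qed

text \<open>The lower bounds form a definable set, and their supremum is the infimum.\<close>

lemma ex_is_inf:
  assumes "dpred M (\<lambda>e. P (e 0))" and "P x" and "\<And>x. P x \<Longrightarrow> b \<le> x"
  shows "\<exists>c. is_inf P c"
proof -
  have "dpred M (\<lambda>e. \<forall>x. P x \<longrightarrow> e 0 \<le> x)"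
    by (intro dintros dpred_app[OF assms(1)])
  then have "\<exists>c. is_sup (\<lambda>c. \<forall>x. P x \<longrightarrow> c \<le> x) c"
    by (rule ex_is_sup[where x = b and b = x]) (use assms in auto)
  then show ?thesis using is_inf_lower_bounds by blast
qed

text \<open>If the union were infinite, then \<open>x \<mapsto> Sup {d. G d x}\<close> would have finite fibers and hence an
  image containing an interval, although only finitely many \<open>x\<close> have a value above a given \<open>d\<close>.\<close>

lemma finite_chain_union:
  assumes def_\<Delta>: "dpred M (\<lambda>e. \<Delta> (e 0))" and def_G: "dpred M (\<lambda>e. G (e 0) (e (Suc 0)))"
    and up: "\<And>d d'. \<Delta> d \<Longrightarrow> d \<le> d' \<Longrightarrow> \<Delta> d'"
    and no_least: "\<And>d. \<Delta> d \<Longrightarrow> \<exists>d'<d. \<Delta> d'"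
    and anti: "\<And>d d' x. \<Delta> d \<Longrightarrow> d \<le> d' \<Longrightarrow> G d' x \<Longrightarrow> G d x"
    and fin: "\<And>d. \<Delta> d \<Longrightarrow> finite {x. G d x}"
  shows "finite {x. \<exists>d. \<Delta> d \<and> G d x}"
proof (rule ccontr)
  assume inf: "\<not> ?thesis"
  define T where "T x d \<longleftrightarrow> \<Delta> d \<and> G d x" for x d
  \<comment> \<open>For such \<open>x\<close> the set of \<open>d\<close> with \<open>T x d\<close>
    is nonempty and, by \<open>anti\<close>, bounded above, so it has a supremum.\<close>
  define Y where "Y x \<longleftrightarrow> (\<exists>d. T x d) \<and> (\<exists>d. \<Delta> d \<and> \<not> G d x)" for x
  define W where "W c \<longleftrightarrow> (\<exists>x. Y x \<and> is_sup (T x) c)" for c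
  define f where "f x = (THE c. is_sup (T x) c)" for x
  have f: "f x = c" if "is_sup (T x) c" for x c
    unfolding f_def using that is_sup_unique by blast
  have def_T: "dpred M (\<lambda>e. T (s e) (t e))" if "dterm M s" "dterm M t" for s t
    unfolding T_def by (intro dintros dpred_app[OF def_\<Delta>] dpred_app2[OF def_G] that)
  have def_W: "dpred M (\<lambda>e. W (e 0))"
    unfolding W_def Y_def is_sup_def
    by (intro dintros def_T dpred_app[OF def_\<Delta>] dpred_app2[OF def_G])
  obtain d0 where "\<Delta> d0"
  proof (rule ccontr)
    assume "\<not> thesis"
    then have "{x. \<exists>d. \<Delta> d \<and> G d x} = {}" using that by blast
    then show False using inf by (metis finite.emptyI)
  qed
  \<comment> \<open>Points lying in every \<open>G d\<close> belong to the finite set given by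
    \<open>d0\<close>; discarding them leaves infinitely many points satisfying
    \<open>Y\<close>.\<close>
  then have "finite {x. \<forall>d. \<Delta> d \<longrightarrow> G d x}"
    by (intro finite_subset[OF _ fin[OF \<open>\<Delta> d0\<close>]]) blast
  moreover have "{x. \<exists>d. \<Delta> d \<and> G d x} \<subseteq> {x. \<forall>d. \<Delta> d \<longrightarrow> G d x} \<union> {x. Y x}"
    unfolding Y_def T_def by blast
  ultimately have inf_Y: "infinite {x. Y x}" using inf by (meson finite_UnI finite_subset)
  have sup: "\<exists>c. is_sup (T x) c" if Y: "Y x" for x
  proof -
    obtain d d' where d: "T x d" "\<Delta> d'" "\<not> G d' x" using Y unfolding Y_def by blast
    have "z \<le> d'" if "T x z" for z
      using anti[of d' z x] d that unfolding T_def by (meson linear)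
    then show ?thesis using ex_is_sup[of "T x" d d'] d def_T[OF dterm_const dterm_var] by blast
  qed
  have above: "G d x" if "is_sup (T x) c" "\<Delta> d" "d < c" for x c d
    using is_sup_approx[OF that(1,3)] anti[OF that(2)] unfolding T_def by (meson less_imp_le)
  have W_\<Delta>: "\<Delta> c" if "W c" for c
    using that unfolding W_def Y_def by (metis T_def is_sup_upper up)
  have fin_fiber: "finite {x. Y x \<and> is_sup (T x) c}" if "W c" for c
  proof -
    \<comment> \<open>Every \<open>x\<close> with supremum \<open>c\<close> lies in
      \<open>G d\<close> for this smaller \<open>d\<close>, hence in a finite set.\<close>
    obtain d where d: "d < c" "\<Delta> d" using no_least[OF W_\<Delta>[OF \<open>W c\<close>]] by blast
    show ?thesis by (rule finite_subset[OF _ fin[OF d(2)]]) (use above d in blast)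
  qed
  have "{x. Y x} \<subseteq> (\<Union>c\<in>{c. W c}. {x. Y x \<and> is_sup (T x) c})"
    using sup unfolding W_def by blast
  then have "infinite {c. W c}" using inf_Y fin_fiber by (metis (mono_tags) finite_UN_I finite_subset mem_Collect_eq)
  then obtain p q where pq: "p < q" "\<And>c. p < c \<Longrightarrow> c < q \<Longrightarrow> W c"
    using infinite_imp_interval[OF def_W] by blast
  obtain c where c: "p < c" "c < q" using dense pq(1) by blast
  have "{c<..<q} \<subseteq> f ` {x. G c x}"
  proof
    fix z assume z: "z \<in> {c<..<q}"
    then obtain x where "is_sup (T x) z" using pq c unfolding W_def by (meson greaterThanLessThan_iff less_trans)
    then show "z \<in> f ` {x. G c x}" using above W_\<Delta> pq c z f by force
  qed
  moreover have "finite {x. G c x}" using fin W_\<Delta> pq c by blast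
  ultimately show False using infinite_Ioo[OF c(2)] by (meson finite_imageI finite_subset)
qed

text \<open>Otherwise, for infinitely many \<open>x\<close> the set \<open>{c. E c x}\<close> contains an interval of a common
  length \<open>\<epsilon>\<close> whose left end can be chosen as a function \<open>f x\<close> with finite fibers. The image of \<open>f\<close>
  then contains an interval, which may be taken shorter than \<open>\<epsilon>\<close>, and its right end \<open>q\<close> satisfies
  \<open>E q x\<close> for infinitely many \<open>x\<close>.\<close>

lemma finite_infinite_fibers:
  assumes def_E: "dpred M (\<lambda>e. E (e 0) (e (Suc 0)))"
    and fin: "\<And>c. finite {x. E c x}"
  shows "finite {x. infinite {c. E c x}}"
proof (rule ccontr)
  assume inf: "\<not> ?thesis"
  note dE = dpred_app2[OF def_E]
  \<comment> \<open>The bound \<open>\<tau>\<close> keeps left ends bounded below, so that their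
    infimum exists later. By \<open>finite_chain_union\<close> with trivial \<open>\<Delta>\<close>,
    one \<open>\<tau>\<close> serves infinitely many \<open>x\<close>.\<close>
  define D where "D \<tau> x \<longleftrightarrow> (\<exists>a b. \<tau> < a \<and> a < b \<and> (\<forall>c. a < c \<and> c < b \<longrightarrow> E c x))" for \<tau> x
  have "\<exists>\<tau>. infinite {x. D \<tau> x}"
  proof (rule ccontr)
    assume "\<nexists>\<tau>. infinite {x. D \<tau> x}"
    then have "finite {x. \<exists>\<tau>. True \<and> D \<tau> x}"
      by (intro finite_chain_union)
        (auto simp: D_def lt_ex intro!: dintros dE dpred_not[OF dpred_False, simplified]
          intro: le_less_trans)
    moreover have "{x. infinite {c. E c x}} \<subseteq> {x. \<exists>\<tau>. True \<and> D \<tau> x}"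
    proof clarify
      fix x assume "infinite {c. E c x}"
      then obtain a b where "a < b" "\<forall>c. a < c \<and> c < b \<longrightarrow> E c x"
        using infinite_imp_interval[of "\<lambda>c. E c x"] dE[OF dterm_var dterm_const] by blast
      then show "\<exists>\<tau>. True \<and> D \<tau> x" unfolding D_def using lt_ex[of a] by blast
    qed
    ultimately show False using inf finite_subset by blast
  qed
  then obtain \<tau> where inf_\<tau>: "infinite {x. D \<tau> x}" ..
  define A where "A \<epsilon> x a \<longleftrightarrow> \<tau> < a \<and> (\<forall>c. a < c \<and> c < a + \<epsilon> \<longrightarrow> E c x)" for \<epsilon> x a
  \<comment> \<open>A second use of \<open>finite_chain_union\<close>, with
    \<open>0 < \<epsilon>\<close> as \<open>\<Delta>\<close>, yields the common length.\<close>
  have "\<exists>\<epsilon>>0. infinite {x. \<exists>a. A \<epsilon> x a}"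
  proof (rule ccontr)
    assume fin': "\<not> (\<exists>\<epsilon>>0. infinite {x. \<exists>a. A \<epsilon> x a})"
    have anti: "A d x a" if "d \<le> d'" "A d' x a" for d d' x a
      using that group_add_le_cancel_left[of a d d'] unfolding A_def by (meson order_less_le_trans)
    have "finite {x. \<exists>\<epsilon>. 0 < \<epsilon> \<and> (\<exists>a. A \<epsilon> x a)}"
    proof (rule finite_chain_union)
      show "dpred M (\<lambda>e. \<exists>a. A (e 0) (e (Suc 0)) a)"
        unfolding A_def by (intro dintros dE)
      show "\<exists>d'<d. 0 < d'" if "0 < d" for d :: 'a
        using dense[OF that] by blast
      show "\<exists>a. A d x a" if "d \<le> d'" "\<exists>a. A d' x a" for d d' x
        using anti that by blast
    qed (use fin' in \<open>auto intro!: dintros\<close>)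
    moreover have "{x. D \<tau> x} \<subseteq> {x. \<exists>\<epsilon>. 0 < \<epsilon> \<and> (\<exists>a. A \<epsilon> x a)}"
    proof clarify
      fix x assume "D \<tau> x"
      then obtain a b where ab: "\<tau> < a" "a < b" "\<forall>c. a < c \<and> c < b \<longrightarrow> E c x"
        unfolding D_def by blast
      \<comment> \<open>The difference is formed on the left, so that
        \<open>a + (- a + b) = b\<close> holds without commutativity.\<close>
      have "A (- a + b) x a" unfolding A_def using ab by (simp add: add.assoc[symmetric])
      moreover have "0 < - a + b" using group_add_less_cancel_left[of "- a" a b] ab by simp
      ultimately show "\<exists>\<epsilon>>0. \<exists>a. A \<epsilon> x a" by blast
    qed
    ultimately show False using inf_\<tau> finite_subset by blast
  qed
  then obtain \<epsilon> where \<epsilon>: "0 < \<epsilon>" "infinite {x. \<exists>a. A \<epsilon> x a}" by blast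
  have def_A: "dpred M (\<lambda>e. A \<epsilon> (s e) (t e))" if "dterm M s" "dterm M t" for s t
  proof -
    have "dpred M (\<lambda>e. A \<epsilon> (e 0) (e (Suc 0)))" unfolding A_def by (intro dintros dE)
    then show ?thesis using that by (rule dpred_app2)
  qed
  define W where "W a \<longleftrightarrow> (\<exists>x. (\<exists>b. A \<epsilon> x b) \<and> is_inf (A \<epsilon> x) a)" for a
  define f where "f x = (THE a. is_inf (A \<epsilon> x) a)" for x
  have f: "f x = a" if "is_inf (A \<epsilon> x) a" for x a
    unfolding f_def using that is_inf_unique by blast
  have def_W: "dpred M (\<lambda>e. W (e 0))"
    unfolding W_def is_inf_def by (intro dintros def_A)
  have inf_ex: "\<exists>a. is_inf (A \<epsilon> x) a" if Ab: "A \<epsilon> x b" for x b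
  proof (rule ex_is_inf[of "A \<epsilon> x" b \<tau>])
    show "\<tau> \<le> a" if "A \<epsilon> x a" for a
      using that less_imp_le unfolding A_def by blast
    show "dpred M (\<lambda>e. A \<epsilon> x (e 0))" by (intro def_A dintros)
  qed (rule Ab)
  \<comment> \<open>The infimum need not satisfy \<open>A \<epsilon> x\<close> itself, but an
    admissible \<open>b\<close> with \<open>a \<le> b < c\<close> covers \<open>c\<close>, since
    \<open>c < a + \<epsilon> \<le> b + \<epsilon>\<close>.\<close>
  have E: "E c x" if inf_a: "is_inf (A \<epsilon> x) a" and c: "a < c" "c < a + \<epsilon>" for a c x
  proof -
    obtain b where b: "A \<epsilon> x b" "b < c" using is_inf_approx[OF inf_a c(1)] by blast
    have "a + \<epsilon> \<le> b + \<epsilon>" using is_inf_lower[OF inf_a b(1)] by (simp add: group_add_order)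
    then show ?thesis using b c(2) unfolding A_def by (meson order_less_le_trans)
  qed
  have fin_fiber: "finite {x. is_inf (A \<epsilon> x) a}" for a
  proof -
    obtain c where "a < c" "c < a + \<epsilon>" using dense less_add_pos[OF \<epsilon>(1)] by blast
    then show ?thesis by (intro finite_subset[OF _ fin[of c]]) (use E in blast)
  qed
  have "{x. \<exists>a. A \<epsilon> x a} \<subseteq> (\<Union>a\<in>{a. W a}. {x. is_inf (A \<epsilon> x) a})"
  proof
    fix x assume "x \<in> {x. \<exists>a. A \<epsilon> x a}"
    then obtain b where b: "A \<epsilon> x b" by blast
    then obtain a where a: "is_inf (A \<epsilon> x) a" using inf_ex by blast
    then have "W a" unfolding W_def using b by blast
    then show "x \<in> (\<Union>a\<in>{a. W a}. {x. is_inf (A \<epsilon> x) a})" using a by blast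
  qed
  then have "infinite {a. W a}"
    using \<epsilon>(2) fin_fiber finite_UN_I[of "{a. W a}" "\<lambda>a. {x. is_inf (A \<epsilon> x) a}"] finite_subset by blast
  then obtain p q' where pq': "p < q'" "\<And>a. p < a \<Longrightarrow> a < q' \<Longrightarrow> W a"
    using infinite_imp_interval[OF def_W] by blast
  \<comment> \<open>The cap \<open>p + \<epsilon>\<close> gives \<open>q < a + \<epsilon>\<close>
    for all \<open>a\<close> above \<open>p\<close>, so the intervals starting between
    \<open>p\<close> and \<open>q\<close> all contain \<open>q\<close>.\<close>
  define q where "q = min q' (p + \<epsilon>)"
  have q: "p < q" using pq'(1) less_add_pos[OF \<epsilon>(1)] by (simp add: q_def)
  have "{p<..<q} \<subseteq> f ` {x. E q x}"
  proof
    fix a assume a: "a \<in> {p<..<q}"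
    then obtain x where x: "is_inf (A \<epsilon> x) a" using pq' unfolding W_def q_def by auto
    have "q \<le> p + \<epsilon>" by (simp add: q_def)
    also have "\<dots> < a + \<epsilon>" using a by (simp add: group_add_order)
    finally have "E q x" using E[OF x] a by simp
    then show "a \<in> f ` {x. E q x}" using f[OF x] by force
  qed
  then show False using infinite_Ioo[OF q] fin[of q] by (meson finite_imageI finite_subset)
qed

end

section \<open>Definable directed covers\<close>

context o_minimal_expansion
begin

text \<open>This replaces a dimension count: finite sets depending on \<open>k\<close> parameters cannot contain all
  finite subsets of an interval. In the induction step, the points of a suitable finite set \<open>Y\<close>
  leave only finitely many choices for the first parameter.\<close>

lemma ex_uncovered_finite_subset:
  fixes a b :: 'a
  assumes "drel M (Suc k) E" and "\<And>v. length v = k \<Longrightarrow> finite {x. E (x # v)}" and "a < b"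
  shows "\<exists>Y\<subseteq>{a<..<b}. finite Y \<and> (\<forall>v. length v = k \<longrightarrow> (\<exists>y\<in>Y. \<not> E (y # v)))"
  using assms(1,2)
proof (induction k arbitrary: E)
  case 0
  then have "\<exists>y\<in>{a<..<b}. \<not> E [y]"
    using infinite_Ioo[OF assms(3)] by (metis finite_subset length_0_conv mem_Collect_eq subsetI)
  then obtain y where "y \<in> {a<..<b}" "\<not> E [y]" by blast
  then show ?case by (intro exI[of _ "{y}"]) auto
next
  case (Suc k)
  note def_E = drelD[OF Suc.prems(1)]
  \<comment> \<open>The head of \<open>l\<close> is a point, the tail holds the parameters after the
    first one. \<open>D\<close> says that infinitely many first parameters admit the point, in
    first-order form.\<close>
  define D where "D l \<longleftrightarrow> (\<exists>p q. p < q \<and> (\<forall>c. p < c \<and> c < q \<longrightarrow> E (hd l # c # tl l)))" for l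
  have D: "D (x # w) \<longleftrightarrow> infinite {c. E (x # c # w)}" if "length w = k" for x w
    unfolding D_def list.sel
    by (rule infinite_iff_interval[symmetric], rule def_E) (use that in \<open>auto intro!: dintros\<close>)
  have "\<exists>Y\<subseteq>{a<..<b}. finite Y \<and> (\<forall>w. length w = k \<longrightarrow> (\<exists>y\<in>Y. \<not> D (y # w)))"
  proof (rule Suc.IH)
    show "drel M (Suc k) D"
      by (rule drel_SucI, unfold D_def list.sel, intro dintros def_E) simp_all
    show "finite {x. D (x # w)}" if w: "length w = k" for w
      unfolding D[OF w]
    proof (rule finite_infinite_fibers)
      show "dpred M (\<lambda>e. E (e (Suc 0) # e 0 # w))"
        by (intro dintros def_E) (use w in simp_all)
      show "finite {x. E (x # c # w)}" for c
        using Suc.prems(2)[of "c # w"] w by simp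
    qed
  qed
  then obtain Y where Y: "Y \<subseteq> {a<..<b}" "finite Y" "\<And>w. length w = k \<Longrightarrow> \<exists>y\<in>Y. \<not> D (y # w)"
    by blast
  \<comment> \<open>Only the finitely many first parameters left by such points of \<open>Y\<close>
    are used, so the fibers of \<open>E'\<close> are finite again.\<close>
  define E' where "E' l \<longleftrightarrow> (\<exists>c. E (hd l # c # tl l) \<and> (\<exists>x\<in>Y. \<not> D (x # tl l) \<and> E (x # c # tl l)))" for l
  have "\<exists>Z\<subseteq>{a<..<b}. finite Z \<and> (\<forall>w. length w = k \<longrightarrow> (\<exists>y\<in>Z. \<not> E' (y # w)))"
  proof (rule Suc.IH)
    show "drel M (Suc k) E'"
      by (rule drel_SucI, unfold E'_def D_def list.sel, intro dintros dpred_Bex Y(2) def_E) simp_all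
    show "finite {y. E' (y # w)}" if w: "length w = k" for w
    proof -
      have "{y. E' (y # w)} = (\<Union>x\<in>{x\<in>Y. \<not> D (x # w)}. \<Union>c\<in>{c. E (x # c # w)}. {y. E (y # c # w)})"
        unfolding E'_def by auto
      also have "finite \<dots>"
        using Y(2) D[OF w] Suc.prems(2) w by (intro finite_UN_I) auto
      finally show ?thesis .
    qed
  qed
  then obtain Z where Z: "Z \<subseteq> {a<..<b}" "finite Z" "\<And>w. length w = k \<Longrightarrow> \<exists>y\<in>Z. \<not> E' (y # w)"
    by blast
  have "\<exists>y\<in>Y \<union> Z. \<not> E (y # v)" if v: "length v = Suc k" for v
  proof (rule ccontr)
    assume E: "\<not> ?thesis"
    obtain c w where cw: "v = c # w" "length w = k" using v by (auto simp: length_Suc_conv)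
    obtain x where "x \<in> Y" "\<not> D (x # w)" using Y(3) cw by blast
    \<comment> \<open>Since \<open>c\<close> admits \<open>x\<close>, it is one of the finitely many
      parameters gathered in \<open>E'\<close>.\<close>
    then have "\<forall>y\<in>Z. E' (y # w)" unfolding E'_def using E cw by auto
    then show False using Z(3) cw by blast
  qed
  then show ?case using Y Z by (intro exI[of _ "Y \<union> Z"]) auto
qed

end

text \<open>Families of subsets of \<open>R\<^sup>m\<close> indexed by two scales \<open>s\<close>, \<open>t\<close> and a point of \<open>R\<^sup>k\<close>.\<close>

definition dfam :: "('a::{plus, ord}, 'f, 'r) expansion \<Rightarrow> nat \<Rightarrow> nat \<Rightarrow>
    ('a \<Rightarrow> 'a \<Rightarrow> 'a list \<Rightarrow> 'a list \<Rightarrow> bool) \<Rightarrow> bool" where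
  "dfam M k m U \<longleftrightarrow>
     drel M (2 + k + m) (\<lambda>l. U (l ! 0) (l ! 1) (take k (drop 2 l)) (drop (2 + k) l))"

lemma dfamI:
  fixes M :: "('a::{plus, ord}, 'f, 'r) expansion"
  assumes "dpred M (\<lambda>e. U (e 0) (e 1) (map (\<lambda>i. e (i + 2)) [0..<k]) (map (\<lambda>i. e (i + (2 + k))) [0..<m]))"
  shows "dfam M k m U"
proof -
  define N where "N = 2 + k + m"
  have "take k (drop 2 (map e [0..<N])) = map (\<lambda>i. e (i + 2)) [0..<k]"
    and "drop (2 + k) (map e [0..<N]) = map (\<lambda>i. e (i + (2 + k))) [0..<m]"
    and "map e [0..<N] ! 0 = e 0" and "map e [0..<N] ! 1 = e 1" for e :: "nat \<Rightarrow> 'a"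
    by (auto intro!: nth_equalityI simp: drop_map take_map N_def add.commute add.left_commute simp del: upt_Suc)
  then show ?thesis using assms unfolding dfam_def drel_def N_def by (simp only:)
qed

lemma dfamD:
  assumes "dfam M k m U" and "dterm M s" and "dterm M t" and "dlist M v" and "\<And>e. length (v e) = k"
    and "dlist M x" and "\<And>e. length (x e) = m"
  shows "dpred M (\<lambda>e. U (s e) (t e) (v e) (x e))"
  using drelD[OF assms(1)[unfolded dfam_def], of "\<lambda>e. s e # t e # v e @ x e"] assms(2-)
  by (simp add: dlist_Cons dlist_append)

section \<open>Monotone covers indexed by a definable directed set\<close>

locale definable_directed = o_minimal_expansion M
  for M :: "('a::{linordered_group_add, unbounded_dense_linorder}, 'f, 'r) expansion" +
  fixes k :: nat and \<Omega> :: "'a list \<Rightarrow> bool" and r :: "'a list \<Rightarrow> 'a list \<Rightarrow> bool"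
  assumes def_\<Omega>: "drel M k \<Omega>"
    and \<Omega>_length: "\<Omega> v \<Longrightarrow> length v = k"
    and \<Omega>_nonempty: "\<exists>v. \<Omega> v"
    and directed: "\<Omega> v \<Longrightarrow> \<Omega> w \<Longrightarrow> \<exists>z. \<Omega> z \<and> r z v \<and> r z w"
begin

text \<open>The model case is "\<open>v\<close> lies below \<open>x\<close>, if \<open>x\<close> is
  in \<open>\<Omega>\<close>", at every scale alike. Dependence on the scales arises only in the
  induction on coordinates.\<close>

definition monotone_cover :: "'b set \<Rightarrow> ('a \<Rightarrow> 'a \<Rightarrow> 'a list \<Rightarrow> 'b \<Rightarrow> bool) \<Rightarrow> bool" where
  "monotone_cover X U \<longleftrightarrow>
     (\<forall>s>0. \<forall>t>0. \<forall>v w. \<forall>x\<in>X. \<Omega> v \<and> \<Omega> w \<and> r w v \<and> U s t v x \<longrightarrow> U s t w x) \<and>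
     (\<forall>s t s' t' v. \<forall>x\<in>X. 0 < s' \<and> s' \<le> s \<and> 0 < t \<and> t \<le> t' \<and> U s' t' v x \<longrightarrow> U s t v x) \<and>
     (\<forall>s>0. \<forall>t>0. \<forall>x\<in>X. \<exists>v. \<Omega> v \<and> U s t v x)"

definition exhausts :: "('a \<Rightarrow> 'a \<Rightarrow> 'b \<Rightarrow> bool) \<Rightarrow> 'b set \<Rightarrow> bool" where
  "exhausts K X \<longleftrightarrow>
     (\<forall>s t s' t'. \<forall>x\<in>X. 0 < s' \<and> s' \<le> s \<and> 0 < t \<and> t \<le> t' \<and> K s t x \<longrightarrow> K s' t' x) \<and>
     (\<forall>x\<in>X. \<exists>s>0. \<exists>t>0. K s t x)"

definition dominated ::
  "('a \<Rightarrow> 'a \<Rightarrow> 'b \<Rightarrow> bool) \<Rightarrow> 'b set \<Rightarrow> ('a \<Rightarrow> 'a \<Rightarrow> 'a list \<Rightarrow> 'b \<Rightarrow> bool) \<Rightarrow> bool" where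
  "dominated K X U \<longleftrightarrow>
     (\<forall>s>0. \<forall>t>0. \<exists>v. \<Omega> v \<and> (\<forall>x\<in>X. K s t x \<longrightarrow> U s t v x))"

text \<open>The core omits punctured neighbourhoods of size \<open>s\<close> around all exceptional points. Taking
  exceptional points over all scales makes the core monotone in the scales.\<close>

definition bad_point :: "('a \<Rightarrow> 'a \<Rightarrow> 'a list \<Rightarrow> 'a \<Rightarrow> bool) \<Rightarrow> 'a \<Rightarrow> 'a \<Rightarrow> 'a \<Rightarrow> bool" where
  "bad_point U s t u \<longleftrightarrow> \<not> (\<exists>v. length v = k \<and> \<Omega> v \<and>
     (\<exists>a b. a < u \<and> u < b \<and> (\<forall>y. a < y \<and> y < b \<longrightarrow> U s t v y)))"

definition exceptional :: "('a \<Rightarrow> 'a \<Rightarrow> 'a list \<Rightarrow> 'a \<Rightarrow> bool) \<Rightarrow> 'a \<Rightarrow> bool" where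
  "exceptional U u \<longleftrightarrow> (\<exists>s t. 0 < s \<and> 0 < t \<and> bad_point U s t u)"

definition core :: "('a \<Rightarrow> 'a \<Rightarrow> 'a list \<Rightarrow> 'a \<Rightarrow> bool) \<Rightarrow> 'a \<Rightarrow> 'a \<Rightarrow> 'a \<Rightarrow> bool" where
  "core U s t y \<longleftrightarrow> y \<le> t \<and> 0 \<le> y + t \<and>
     (\<forall>u. exceptional U u \<longrightarrow> \<not> (u < y \<and> y < u + s) \<and> \<not> (y < u \<and> u < y + s))"

lemma monotone_cover_index:
  assumes "monotone_cover X U" "0 < s" "0 < t" "x \<in> X" "\<Omega> v" "\<Omega> w" "r w v" "U s t v x"
  shows "U s t w x"
  using assms(1)[unfolded monotone_cover_def, THEN conjunct1, rule_format, of s t x v w] assms(2-)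
  by simp

lemma monotone_cover_scale:
  assumes "monotone_cover X U" "0 < s'" "s' \<le> s" "0 < t" "t \<le> t'" "x \<in> X" "U s' t' v x"
  shows "U s t v x"
  using assms(1)[unfolded monotone_cover_def, THEN conjunct2, THEN conjunct1, rule_format, of x s' s t t' v]
    assms(2-) by simp

lemma monotone_cover_ex:
  assumes "monotone_cover X U" "0 < s" "0 < t" "x \<in> X"
  obtains v where "\<Omega> v" "U s t v x"
  using assms(1)[unfolded monotone_cover_def, THEN conjunct2, THEN conjunct2, rule_format, of s t x]
    assms(2-) that by blast

lemma monotone_coverI:
  assumes "\<And>s t v w x. \<lbrakk>0 < s; 0 < t; x \<in> X; \<Omega> v; \<Omega> w; r w v; U s t v x\<rbrakk> \<Longrightarrow> U s t w x"
    and "\<And>s t s' t' v x. \<lbrakk>0 < s'; s' \<le> s; 0 < t; t \<le> t'; x \<in> X; U s' t' v x\<rbrakk> \<Longrightarrow> U s t v x"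
    and "\<And>s t x. \<lbrakk>0 < s; 0 < t; x \<in> X\<rbrakk> \<Longrightarrow> \<exists>v. \<Omega> v \<and> U s t v x"
  shows "monotone_cover X U"
  unfolding monotone_cover_def
  by (intro conjI allI ballI impI; (elim conjE)?; rule assms; assumption)

lemma exhausts_mono:
  assumes "exhausts K X" "x \<in> X" "0 < s'" "s' \<le> s" "0 < t" "t \<le> t'" "K s t x"
  shows "K s' t' x"
  using assms(1)[unfolded exhausts_def, THEN conjunct1, rule_format, of x s' s t t'] assms(2-) by simp

lemma exhausts_ex:
  assumes "exhausts K X" "x \<in> X"
  obtains s t where "0 < s" "0 < t" "K s t x"
  using assms(1)[unfolded exhausts_def, THEN conjunct2, rule_format, of x] assms(2) that by blast

lemma dominatedE:
  assumes "dominated K X U" "0 < s" "0 < t"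
  obtains v where "\<Omega> v" "\<And>x. x \<in> X \<Longrightarrow> K s t x \<Longrightarrow> U s t v x"
  using assms(1)[unfolded dominated_def, rule_format, OF assms(2,3)] that by blast

lemma exhaustsI:
  assumes "\<And>s t s' t' x. \<lbrakk>x \<in> X; 0 < s'; s' \<le> s; 0 < t; t \<le> t'; K s t x\<rbrakk> \<Longrightarrow> K s' t' x"
    and "\<And>x. x \<in> X \<Longrightarrow> \<exists>s>0. \<exists>t>0. K s t x"
  shows "exhausts K X"
  unfolding exhausts_def by (intro conjI allI ballI impI; (elim conjE)?; rule assms; assumption)

text \<open>Directedness merges the indices of single points, and passing to a lower index keeps
  points already covered.\<close>

lemma finite_common_bound:
  assumes "finite Y" and "Y \<subseteq> X" and "monotone_cover X U" and "0 < s" and "0 < t"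
  shows "\<exists>v. \<Omega> v \<and> (\<forall>y\<in>Y. U s t v y)"
  using assms(1,2)
proof (induction Y rule: finite_induct)
  case empty
  then show ?case using \<Omega>_nonempty by blast
next
  case (insert y Y)
  then obtain v where v: "\<Omega> v" "\<forall>y\<in>Y. U s t v y" by blast
  obtain w where w: "\<Omega> w" "U s t w y"
    using monotone_cover_ex[OF assms(3-5)] insert.prems by blast
  obtain z where z: "\<Omega> z" "r z v" "r z w" using directed v w by blast
  have "U s t z x" if "x \<in> insert y Y" for x
    using monotone_cover_index[OF assms(3-5), of x v z] monotone_cover_index[OF assms(3-5), of x w z]
      insert.prems v w z that by blast
  then show ?case using z by blast
qed

lemma core_mono:
  assumes "core U s t y" and "s' \<le> s" and "t \<le> t'"
  shows "core U s' t' y"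
proof -
  have "z + s' \<le> z + s" "y + t \<le> y + t'" for z using assms(2,3) by (simp_all add: group_add_order)
  then show ?thesis using assms unfolding core_def by (meson order_trans order_less_le_trans)
qed

section \<open>Exceptional points and the core of a monotone cover of the line\<close>

context
  fixes U
  assumes def_U: "\<And>s t v y. \<lbrakk>dterm M s; dterm M t; dlist M v; \<And>e. length (v e) = k; dterm M y\<rbrakk>
      \<Longrightarrow> dpred M (\<lambda>e. U (s e) (t e) (v e) (y e))"
    and cover: "monotone_cover UNIV U"
begin

lemma mono_index: "\<lbrakk>0 < s; 0 < t; \<Omega> v; \<Omega> w; r w v; U s t v x\<rbrakk> \<Longrightarrow> U s t w x"
  by (rule monotone_cover_index[OF cover]) simp_all

lemma mono_scale: "\<lbrakk>0 < s'; s' \<le> s; 0 < t; t \<le> t'; U s' t' v x\<rbrakk> \<Longrightarrow> U s t v x"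
  by (rule monotone_cover_scale[OF cover]) simp_all

lemma bad_point_mono:
  "\<lbrakk>bad_point U s t u; 0 < s'; s' \<le> s; 0 < t; t \<le> t'\<rbrakk> \<Longrightarrow> bad_point U s' t' u"
  using mono_scale unfolding bad_point_def by blast

text \<open>Infinitely many bad points would fill an interval. No \<open>U s t v\<close> with
  \<open>\<Omega> v\<close> contains a subinterval of it, so each meets it in a finite set; yet
  every finite subset has a common index, against \<open>ex_uncovered_finite_subset\<close>.\<close>

lemma finite_bad_points:
  assumes st: "0 < s" "0 < t"
  shows "finite {u. bad_point U s t u}"
proof (rule ccontr)
  assume inf: "infinite {u. bad_point U s t u}"
  have "dpred M (\<lambda>e. bad_point U s t (e 0))"
    unfolding bad_point_def by (intro dintros def_U drelD[OF def_\<Omega>]) simp_all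
  then obtain a b where ab: "a < b" "\<And>u. a < u \<Longrightarrow> u < b \<Longrightarrow> bad_point U s t u"
    using infinite_imp_interval inf by blast
  define E where "E l \<longleftrightarrow> \<Omega> (tl l) \<and> a < hd l \<and> hd l < b \<and> U s t (tl l) (hd l)" for l
  have "\<exists>Y\<subseteq>{a<..<b}. finite Y \<and> (\<forall>v. length v = k \<longrightarrow> (\<exists>y\<in>Y. \<not> E (y # v)))"
  proof (rule ex_uncovered_finite_subset[OF _ _ ab(1)])
    show "drel M (Suc k) E"
      by (rule drel_SucI, unfold E_def list.sel, intro dintros def_U drelD[OF def_\<Omega>]) simp_all
    show "finite {x. E (x # v)}" if v: "length v = k" for v
    proof (rule ccontr)
      have "dpred M (\<lambda>e. E (e 0 # v))"
        unfolding E_def list.sel by (intro dintros def_U drelD[OF def_\<Omega>]) (use v in simp_all)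
      moreover assume "infinite {x. E (x # v)}"
      ultimately obtain p q where pq: "p < q" "\<And>x. p < x \<Longrightarrow> x < q \<Longrightarrow> E (x # v)"
        using infinite_imp_interval[of "\<lambda>x. E (x # v)"] by blast
      obtain u where "p < u" "u < q" using dense pq by blast
      then have "\<not> bad_point U s t u"
        using pq v unfolding bad_point_def E_def list.sel by blast
      then show False using ab(2) pq(2)[OF \<open>p < u\<close> \<open>u < q\<close>] unfolding E_def by simp
    qed
  qed
  then obtain Y where Y: "Y \<subseteq> {a<..<b}" "finite Y" "\<And>v. length v = k \<Longrightarrow> \<exists>y\<in>Y. \<not> E (y # v)"
    by blast
  obtain v where v: "\<Omega> v" "\<forall>y\<in>Y. U s t v y"
    using finite_common_bound[OF Y(2) _ cover st] by blast
  then have "\<forall>y\<in>Y. E (y # v)" using Y(1) unfolding E_def by auto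
  then show False using Y(3) \<Omega>_length v by blast
qed

text \<open>The same contradiction, with the pair of scales as parameters in place of
  \<open>v\<close>: bad sets at fixed scales are finite, and they grow as the scales get
  finer.\<close>

lemma finite_exceptional: "finite {u. exceptional U u}"
proof (rule ccontr)
  assume inf: "infinite {u. exceptional U u}"
  have def_bad: "dpred M (\<lambda>e. bad_point U (e (Suc 0)) (e (Suc (Suc 0))) (e 0))"
    unfolding bad_point_def by (intro dintros def_U drelD[OF def_\<Omega>]) simp_all
  have "dpred M (\<lambda>e. exceptional U (e 0))"
    unfolding exceptional_def bad_point_def
    by (intro dintros def_U drelD[OF def_\<Omega>]) simp_all
  then obtain a b where ab: "a < b" "\<And>u. a < u \<Longrightarrow> u < b \<Longrightarrow> exceptional U u"
    using infinite_imp_interval inf by blast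
  define E where "E l \<longleftrightarrow> 0 < l ! 1 \<and> 0 < l ! 2 \<and> bad_point U (l ! 1) (l ! 2) (l ! 0)" for l
  have "\<exists>Y\<subseteq>{a<..<b}. finite Y \<and> (\<forall>v. length v = 2 \<longrightarrow> (\<exists>y\<in>Y. \<not> E (y # v)))"
  proof (rule ex_uncovered_finite_subset[OF _ _ ab(1)])
    show "drel M (Suc 2) E"
      using def_bad unfolding drel_def E_def
      by (simp add: numeral_2_eq_2) (intro dintros)
    show "finite {x. E (x # v)}" for v
      using finite_bad_points unfolding E_def by (cases "0 < v ! 0 \<and> 0 < v ! 1") auto
  qed
  then obtain Y where Y: "Y \<subseteq> {a<..<b}" "finite Y" "\<And>v. length v = 2 \<Longrightarrow> \<exists>y\<in>Y. \<not> E (y # v)"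
    by blast
  have "\<exists>s t. 0 < s \<and> 0 < t \<and> (\<forall>u\<in>Y. bad_point U s t u)"
    using Y(2,1)
  proof (induction Y rule: finite_induct)
    case empty
    then show ?case using gt_ex[of 0] by blast
  next
    case (insert u Y)
    then obtain s t where st: "0 < s" "0 < t" "\<forall>u\<in>Y. bad_point U s t u" by blast
    obtain s' t' where st': "0 < s'" "0 < t'" "bad_point U s' t' u"
      using ab(2)[of u] insert.prems unfolding exceptional_def by auto
    \<comment> \<open>Minimum and maximum give a common refinement of the two pairs of
      scales.\<close>
    have "bad_point U (min s s') (max t t') x" if "x \<in> insert u Y" for x
      using that st st' bad_point_mono[of s t x "min s s'" "max t t'"]
        bad_point_mono[of s' t' x "min s s'" "max t t'"] by auto
    moreover have "0 < min s s'" and "0 < max t t'" using st st' by (auto simp: less_max_iff_disj)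
    ultimately show ?case by blast
  qed
  then obtain s t where "0 < s" "0 < t" "\<forall>u\<in>Y. bad_point U s t u" by blast
  then have "\<forall>y\<in>Y. E (y # [s, t])" unfolding E_def by simp
  then show False using Y(3)[of "[s, t]"] by auto
qed

text \<open>The finitely many exceptional points other than \<open>y\<close> keep a positive
  distance from \<open>y\<close>; \<open>y\<close> itself may be exceptional, as the omitted
  neighbourhoods are punctured.\<close>

lemma core_exhausts: "exhausts (core U) UNIV"
proof -
  have "\<exists>s>0. \<exists>t>0. core U s t y" for y
  proof -
    have sep: "\<exists>s>0. \<forall>u\<in>B. \<not> (u < y \<and> y < u + s) \<and> \<not> (y < u \<and> u < y + s)" if "finite B" for B
      using that
    proof (induction B rule: finite_induct)
      case empty
      then show ?case using gt_ex[of 0] by blast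
    next
      case (insert u B)
      then obtain s where s: "0 < s" "\<forall>u\<in>B. \<not> (u < y \<and> y < u + s) \<and> \<not> (y < u \<and> u < y + s)" by blast
      have "\<exists>s'>0. \<not> (u < y \<and> y < u + s') \<and> \<not> (y < u \<and> u < y + s')"
      proof (cases u y rule: linorder_cases)
        case less
        then have "0 < - u + y" using group_add_less_cancel_left[of "- u" u y] by simp
        then show ?thesis using less less_not_sym[OF less] by (intro exI[of _ "- u + y"]) (simp add: add.assoc[symmetric])
      next
        case equal
        then show ?thesis using s(1) by blast
      next
        case greater
        then have "0 < - y + u" using group_add_less_cancel_left[of "- y" y u] by simp
        then show ?thesis using greater less_not_sym[OF greater] by (intro exI[of _ "- y + u"]) (simp add: add.assoc[symmetric])
      qed
      then obtain s' where s': "0 < s'" "\<not> (u < y \<and> y < u + s') \<and> \<not> (y < u \<and> u < y + s')" by blast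
      have "z + min s s' \<le> z + s" "z + min s s' \<le> z + s'" for z
        by (simp_all add: group_add_order)
      then show ?case
        using s s' by (intro exI[of _ "min s s'"]) (simp, meson order_less_le_trans)
    qed
    obtain s where s: "0 < s" "\<forall>u. exceptional U u \<longrightarrow> \<not> (u < y \<and> y < u + s) \<and> \<not> (y < u \<and> u < y + s)"
      using sep[OF finite_exceptional] by auto
    obtain t where "max 0 (max y (- y)) < t" using gt_ex by blast
    then have t: "0 < t" "y \<le> t" "- y \<le> t" by auto
    have "0 \<le> y + t" using t(3) group_add_le_cancel_left[of y "- y" t] by simp
    then show ?thesis using s t unfolding core_def by blast
  qed
  then show ?thesis by (intro exhaustsI) (use core_mono in blast)+
qed

text \<open>Definable compactness: the set of \<open>c\<close> such that one index works for all points of the core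
  up to \<open>c\<close> is an initial segment whose supremum cannot be finite.\<close>

lemma core_dominated: "dominated (core U) UNIV U"
proof -
  have "\<exists>v. \<Omega> v \<and> (\<forall>y. core U s t y \<longrightarrow> U s t v y)" if st: "0 < s" "0 < t" for s t
  proof -
    \<comment> \<open>The conjunct \<open>length v = k\<close> puts the quantifier over lists into
      the form handled by \<open>dpred_ex_list\<close>.\<close>
    define C where "C c \<longleftrightarrow> (\<exists>v. length v = k \<and> \<Omega> v \<and> (\<forall>y. y \<le> c \<and> core U s t y \<longrightarrow> U s t v y))" for c
    have local: "\<exists>v a b. \<Omega> v \<and> a < u \<and> u < b \<and> (\<forall>y. a < y \<and> y < b \<and> core U s t y \<longrightarrow> U s t v y)" for u
    proof (cases "bad_point U s t u")
      case False
      then show ?thesis unfolding bad_point_def by blast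
    next
      case True
      \<comment> \<open>Within distance \<open>s\<close> of an exceptional \<open>u\<close> the core
        contains at most \<open>u\<close>, so an index for this single point suffices.\<close>
      then have exc: "exceptional U u" using st unfolding exceptional_def by blast
      obtain v where v: "\<Omega> v" "U s t v u" using finite_common_bound[OF _ _ cover st, of "{u}"] by auto
      have "- s < 0" using group_add_less_cancel_left[of "- s" 0 s] st by simp
      then have "u + - s < u" using group_add_less_cancel_left[of u "- s" 0] by simp
      moreover have "u < u + s" using less_add_pos st by blast
      moreover have "U s t v y" if y: "u + - s < y" "y < u + s" "core U s t y" for y
      proof -
        have "u < y + s" using y(1) group_add_less_cancel_right[of "u + - s" s y] by (simp add: add.assoc)
        then have "y = u" using y(2,3) exc unfolding core_def by (meson linorder_cases)
        then show ?thesis using v by simp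
      qed
      ultimately show ?thesis using v by blast
    qed
    have core_le: "y \<le> t" if "core U s t y" for y using that unfolding core_def by simp
    have def_C: "dpred M (\<lambda>e. C (e 0))"
      unfolding C_def core_def exceptional_def bad_point_def
      by (intro dintros def_U drelD[OF def_\<Omega>]) simp_all
    have down: "C c" if "C d" "c \<le> d" for c d
      using that order_trans[of _ c d] unfolding C_def by blast
    have "C t"
    proof (rule ccontr)
      assume "\<not> C t"
      \<comment> \<open>Below \<open>- t\<close> the core is empty, so \<open>C\<close> holds
        vacuously there and its supremum exists.\<close>
      obtain c where c: "c < - t" using lt_ex by blast
      have "\<not> core U s t y" if "y \<le> c" for y
      proof -
        have "y + t < 0" using that c group_add_less_cancel_right[of y t "- t"] by simp
        then show ?thesis unfolding core_def by (simp add: not_le)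
      qed
      then have "C c" unfolding C_def using \<Omega>_nonempty \<Omega>_length by blast
      then obtain c0 where c0: "is_sup C c0"
        using ex_is_sup[OF def_C] down \<open>\<not> C t\<close> by (meson linear)
      obtain v a b where v: "\<Omega> v" "a < c0" "c0 < b"
        "\<And>y. a < y \<Longrightarrow> y < b \<Longrightarrow> core U s t y \<Longrightarrow> U s t v y" using local by blast
      obtain c1 where c1: "C c1" "a < c1" using is_sup_approx[OF c0 v(2)] by blast
      then obtain w where w: "\<Omega> w" "\<And>y. y \<le> c1 \<Longrightarrow> core U s t y \<Longrightarrow> U s t w y"
        unfolding C_def by blast
      obtain z where z: "\<Omega> z" "r z v" "r z w" using directed v w by blast
      \<comment> \<open>\<open>w\<close> serves the core up to \<open>c1\<close> and
        \<open>v\<close> serves it between \<open>a\<close> and \<open>b\<close>. As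
        \<open>a < c1\<close>, the index \<open>z\<close> below both serves it up to
        \<open>d\<close>, beyond the supremum.\<close>
      obtain d where d: "c0 < d" "d < b" using dense v(3) by blast
      have "U s t z y" if y: "y \<le> d" "core U s t y" for y
      proof (cases "y \<le> c1")
        case True
        then show ?thesis using w y z mono_index st by blast
      next
        case False
        then have "a < y" "y < b" using c1 d y by auto
        then show ?thesis using v y z mono_index st by blast
      qed
      then have "C d" unfolding C_def using z \<Omega>_length by blast
      then show False using is_sup_upper[OF c0] d(1) by (meson leD)
    qed
    then show ?thesis unfolding C_def using core_le by blast
  qed
  then show ?thesis unfolding dominated_def by blast
qed

end

text \<open>The induction peels off one coordinate \<open>y\<close>. Since the core of each fiber grows with the
  scales while \<open>U\<close> shrinks, "the core of the fiber at \<open>x\<close> lies in \<open>U s t v\<close>" is again a monotone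
  cover.\<close>

lemma ex_exhaustion:
  assumes "dfam M k m U" and "monotone_cover {x. length x = m} U"
  shows "\<exists>K. dfam M 0 m (\<lambda>s t _. K s t) \<and> exhausts K {x. length x = m} \<and> dominated K {x. length x = m} U"
  using assms
proof (induction m arbitrary: U)
  case 0
  \<comment> \<open>There is only the empty list to cover, so the trivial family works.\<close>
  have "dfam M 0 0 (\<lambda>s t _ _. True)"
    by (rule dfamI) (rule dpred_not[OF dpred_False, simplified])
  moreover have "exhausts (\<lambda>s t _. True) {x::'a list. length x = 0}"
    by (intro exhaustsI) (use gt_ex[of "0::'a"] in blast)+
  moreover have "dominated (\<lambda>s t _. True) {x. length x = 0} U"
    unfolding dominated_def
  proof (intro allI impI)
    fix s t :: 'a assume "0 < s" "0 < t"
    then obtain v where "\<Omega> v" "U s t v []" by (rule monotone_cover_ex[OF 0(2)]) simp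
    then show "\<exists>v. \<Omega> v \<and> (\<forall>x\<in>{x. length x = 0}. True \<longrightarrow> U s t v x)" by auto
  qed
  ultimately show ?case by (intro exI[of _ "\<lambda>s t _. True"] conjI)
next
  case (Suc m)
  define V where "V x = (\<lambda>s t v y. U s t v (y # x))" for x
  have def_V: "dpred M (\<lambda>e. V x (s e) (t e) (v e) (y e))"
    if "length x = m" "dterm M s" "dterm M t" "dlist M v" "\<And>e. length (v e) = k" "dterm M y" for x s t v y
    unfolding V_def by (intro dfamD[OF Suc.prems(1)] dintros that) (use that in simp_all)
  have cover_V: "monotone_cover UNIV (V x)" if "length x = m" for x
  proof (rule monotone_coverI; unfold V_def)
    fix s t :: 'a and v w y
    assume *: "0 < s" "0 < t" "\<Omega> v" "\<Omega> w" "r w v" "U s t v (y # x)"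
    show "U s t w (y # x)"
      by (rule monotone_cover_index[OF Suc.prems(2), where v = v]) (simp_all add: that *)
  next
    fix s t s' t' :: 'a and v y
    assume *: "0 < s'" "s' \<le> s" "0 < t" "t \<le> t'" "U s' t' v (y # x)"
    show "U s t v (y # x)"
      by (rule monotone_cover_scale[OF Suc.prems(2), where s' = s' and t' = t']) (simp_all add: that *)
  next
    fix s t y :: 'a assume "0 < s" "0 < t"
    then show "\<exists>v. \<Omega> v \<and> U s t v (y # x)"
      using monotone_cover_ex[OF Suc.prems(2), of s t "y # x"] that by auto
  qed
  define U' where "U' s t v x \<longleftrightarrow> (\<forall>y. core (V x) s t y \<longrightarrow> V x s t v y)" for s t v x
  have "dfam M k m U'"
    by (rule dfamI, unfold U'_def core_def exceptional_def bad_point_def V_def,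
      intro dintros dfamD[OF Suc.prems(1)] drelD[OF def_\<Omega>]) simp_all
  moreover have "monotone_cover {x. length x = m} U'"
  proof (rule monotone_coverI)
    fix s t :: 'a and v w x
    assume *: "0 < s" "0 < t" "x \<in> {x. length x = m}" "\<Omega> v" "\<Omega> w" "r w v" "U' s t v x"
    then show "U' s t w x"
      using monotone_cover_index[OF cover_V *(1,2) UNIV_I *(4-6)] unfolding U'_def by blast
  next
    fix s t s' t' :: 'a and v x
    assume *: "0 < s'" "s' \<le> s" "0 < t" "t \<le> t'" "x \<in> {x. length x = m}" "U' s' t' v x"
    \<comment> \<open>The point passes to the larger core at the finer scales \<open>s'\<close>,
      \<open>t'\<close>, is covered there, and remains covered at the coarser scales.\<close>
    have "V x s t v y" if "core (V x) s t y" for y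
    proof -
      have "V x s' t' v y" using * core_mono[OF that] unfolding U'_def by blast
      then show ?thesis using * monotone_cover_scale[OF cover_V *(1-4) UNIV_I] by blast
    qed
    then show "U' s t v x" unfolding U'_def by blast
  next
    fix s t :: 'a and x :: "'a list" assume *: "0 < s" "0 < t" "x \<in> {x. length x = m}"
    \<comment> \<open>That \<open>U'\<close> covers at every scale is exactly the domination of the
      fiber cores.\<close>
    then have "dominated (core (V x)) UNIV (V x)"
      by (intro core_dominated def_V cover_V) simp_all
    then show "\<exists>v. \<Omega> v \<and> U' s t v x"
      using * unfolding dominated_def U'_def by simp
  qed
  ultimately obtain K where K: "dfam M 0 m (\<lambda>s t _. K s t)" "exhausts K {x. length x = m}"
    "dominated K {x. length x = m} U'" using Suc.IH by blast
  define L where "L s t l \<longleftrightarrow> K s t (tl l) \<and> core (V (tl l)) s t (hd l)" for s t l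
  have "dfam M 0 (Suc m) (\<lambda>s t _. L s t)"
    by (rule dfamI, unfold L_def core_def exceptional_def bad_point_def V_def map_upt_Suc list.sel,
      intro dintros dfamD[OF Suc.prems(1)] drelD[OF def_\<Omega>] dfamD[OF K(1), where v = "\<lambda>e. []"]) simp_all
  moreover have "exhausts L {x. length x = Suc m}"
  proof (rule exhaustsI)
    fix s t s' t' :: 'a and x
    assume *: "x \<in> {x. length x = Suc m}" "0 < s'" "s' \<le> s" "0 < t" "t \<le> t'" "L s t x"
    then show "L s' t' x"
      using exhausts_mono[OF K(2) _ *(2-5), of "tl x"] core_mono[of _ s t _ s' t'] unfolding L_def by simp
  next
    fix l :: "'a list" assume "l \<in> {x. length x = Suc m}"
    then have m: "length (tl l) = m" by simp
    obtain s t where st: "0 < s" "0 < t" "K s t (tl l)" using exhausts_ex[OF K(2)] m by blast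
    have "exhausts (core (V (tl l))) UNIV"
      by (intro core_exhausts def_V cover_V m)
    then obtain s' t' where st': "0 < s'" "0 < t'" "core (V (tl l)) s' t' (hd l)"
      by (rule exhausts_ex) simp
    have "K (min s s') (max t t') (tl l)"
      by (rule exhausts_mono[OF K(2) _ _ _ st(2) _ st(3)]) (use st st' m in simp_all)
    moreover have "core (V (tl l)) (min s s') (max t t') (hd l)"
      using core_mono[OF st'(3)] by simp
    moreover have "0 < min s s'" and "0 < max t t'" using st st' by (auto simp: less_max_iff_disj)
    ultimately show "\<exists>s>0. \<exists>t>0. L s t l" unfolding L_def by blast
  qed
  moreover have "dominated L {x. length x = Suc m} U"
    unfolding dominated_def
  proof (intro allI impI)
    fix s t :: 'a assume "0 < s" "0 < t"
    then obtain v where v: "\<Omega> v" "\<And>x. length x = m \<Longrightarrow> K s t x \<Longrightarrow> U' s t v x"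
      by (rule dominatedE[OF K(3)]) simp
    have "U s t v l" if "length l = Suc m" "L s t l" for l
    proof -
      have "V (tl l) s t v (hd l)" using v(2)[of "tl l"] that unfolding L_def U'_def by simp
      then show ?thesis using that(1) unfolding V_def by (cases l) auto
    qed
    then show "\<exists>v. \<Omega> v \<and> (\<forall>x\<in>{x. length x = Suc m}. L s t x \<longrightarrow> U s t v x)" using v by blast
  qed
  ultimately show ?case by (intro exI[of _ L] conjI)
qed

end

section \<open>Definable choice and cofinal maps\<close>

text \<open>The known length of the first component determines where to split, so coding pairs by
  concatenation loses nothing.\<close>

lemma append_mem_iff:
  assumes "\<And>x y. (x, y) \<in> r \<Longrightarrow> length x = n" and "length x = n"
  shows "x @ y \<in> {x @ y | x y. (x, y) \<in> r} \<longleftrightarrow> (x, y) \<in> r"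
proof
  assume "x @ y \<in> {x @ y | x y. (x, y) \<in> r}"
  then obtain x' y' where *: "x @ y = x' @ y'" "(x', y') \<in> r" by blast
  then have "length x' = length x" using assms by simp
  then show "(x, y) \<in> r" using * by simp
qed blast

section \<open>Right germs, definable choice, and the cofinal map\<close>

context o_minimal_expansion
begin

text \<open>The witness \<open>d\<close> is the first endpoint of \<open>A\<close> beyond
  \<open>c\<close>, or the arbitrary point \<open>z\<close> if there is none.\<close>

lemma interval_germ:
  fixes A :: "'a set"
  assumes "A \<in> points_and_intervals"
  shows "\<exists>d>c. {c<..<d} \<subseteq> A \<or> {c<..<d} \<inter> A = {}"
proof -
  obtain z where z: "c < z" using gt_ex by blast
  consider a where "A = {a}" | a b where "A = {a<..<b}" | a where "A = {a<..}"
    | b where "A = {..<b}" | "A = UNIV"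
    using assms unfolding points_and_intervals_def by blast
  then show ?thesis
  proof cases
    case (1 a)
    then show ?thesis using z by (intro exI[of _ "if c < a then a else z"]) auto
  next
    case (2 a b)
    then show ?thesis
      using z by (intro exI[of _ "if c < a then a else if c < b then b else z"]) auto
  next
    case (3 a)
    then show ?thesis using z by (intro exI[of _ "if c < a then a else z"]) auto
  next
    case (4 b)
    then show ?thesis using z by (intro exI[of _ "if c < b then b else z"]) auto
  next
    case 5
    then show ?thesis using z by blast
  qed
qed

text \<open>Germs of the finitely many pieces are combined by taking the smaller \<open>d\<close>.
  For \<open>select\<close> this shows that a definable set whose infimum is not attained contains
  an interval starting there.\<close>

lemma right_germ:
  assumes "dpred M (\<lambda>e. P (e 0))"
  shows "\<exists>d>c. (\<forall>x. c < x \<and> x < d \<longrightarrow> P x) \<or> (\<forall>x. c < x \<and> x < d \<longrightarrow> \<not> P x)"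
proof -
  obtain F where F: "finite F" "F \<subseteq> points_and_intervals" "{x. P x} = \<Union>F"
    using finite_union_of_intervals[OF assms] .
  have "\<exists>d>c. {c<..<d} \<subseteq> \<Union>F \<or> {c<..<d} \<inter> \<Union>F = {}"
    using F(1,2)
  proof (induction F rule: finite_induct)
    case empty
    then show ?case using gt_ex[of c] by simp
  next
    case (insert A F)
    then obtain d where d: "c < d" "{c<..<d} \<subseteq> \<Union>F \<or> {c<..<d} \<inter> \<Union>F = {}" by auto
    obtain d' where d': "c < d'" "{c<..<d'} \<subseteq> A \<or> {c<..<d'} \<inter> A = {}"
      using interval_germ insert.prems by blast
    have sub: "{c<..<min d d'} \<subseteq> {c<..<d}" "{c<..<min d d'} \<subseteq> {c<..<d'}" by auto
    have "c < min d d'" using d d' by simp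
    moreover have "{c<..<min d d'} \<subseteq> \<Union>(insert A F) \<or> {c<..<min d d'} \<inter> \<Union>(insert A F) = {}"
      using d(2) d'(2) sub by (simp only: Union_insert) blast
    ultimately show ?case by blast
  qed
  then obtain d where "c < d" "{c<..<d} \<subseteq> {x. P x} \<or> {c<..<d} \<inter> {x. P x} = {}"
    unfolding F(3) by blast
  then show ?thesis by (intro exI[of _ d]) auto
qed

text \<open>Commutativity and divisibility are not available; the supremum of all \<open>h\<close> with
  \<open>c + (h + h) < d\<close> is a definable replacement for half of the distance.\<close>

lemma half:
  fixes c d :: 'a
  assumes "c < d"
  shows "\<exists>h. is_sup (\<lambda>h. c + (h + h) < d) h"
    and "is_sup (\<lambda>h. c + (h + h) < d) h \<Longrightarrow> c < c + h \<and> c + h < d"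
proof -
  have "0 < - c + d" using group_add_less_cancel_left[of "- c" c d] assms by simp
  then obtain a where a: "0 < a" "a < - c + d" using dense by blast
  \<comment> \<open>The distance is split into positive parts \<open>a\<close> and \<open>b\<close>,
    kept in this order because addition need not commute.\<close>
  define b where "b = - a + (- c + d)"
  have d: "d = c + (a + b)" unfolding b_def by (simp only: add_minus_cancel)
  have b: "0 < b" using a(2) group_add_less_cancel_left[of "- a" a "- c + d"] unfolding b_def by (simp only: left_minus)
  have P: "c + (h + h) < d \<longleftrightarrow> h + h < a + b" for h unfolding d by (simp add: group_add_order)
  obtain m where m: "0 < m" "m < min a b" using dense[of 0 "min a b"] a b by auto
  have "m + m < a + b"
  proof -
    have "m + m < a + m" using m by (simp add: group_add_order)
    also have "\<dots> < a + b" using m by (simp add: group_add_order)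
    finally show ?thesis .
  qed
  then have Pm: "c + (m + m) < d" using P by simp
  \<comment> \<open>If \<open>h\<close> exceeded both parts, \<open>h + h\<close> would exceed
    \<open>a + b\<close>. The bound \<open>max a b\<close> lies below \<open>a + b\<close>, so it
    also keeps \<open>c + h\<close> below \<open>d\<close>.\<close>
  have upper: "h \<le> max a b" if "c + (h + h) < d" for h
  proof (rule ccontr)
    assume "\<not> h \<le> max a b"
    then have "a < h" "b < h" by (simp_all add: not_le)
    then have "a + b < h + b" "h + b < h + h" by (simp_all add: group_add_order)
    then show False using that P by (meson less_asym less_trans)
  qed
  show "\<exists>h. is_sup (\<lambda>h. c + (h + h) < d) h"
    by (rule ex_is_sup[of "\<lambda>h. c + (h + h) < d" m, OF _ Pm upper]) (intro dintros)
  assume h: "is_sup (\<lambda>h. c + (h + h) < d) h"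
  have "m \<le> h" using is_sup_upper[OF h Pm] .
  then have "0 < h" using m by simp
  moreover have "h \<le> max a b" using h upper unfolding is_sup_def by blast
  moreover have "a < a + b" "b < a + b"
    using less_add_pos[OF b] group_add_less_cancel_right[of 0 b a] a by simp_all
  ultimately have "0 < h" "h < a + b" by (auto simp: le_max_iff_disj)
  then show "c < c + h \<and> c + h < d" unfolding d by (simp add: less_add_pos group_add_order)
qed

text \<open>A fixed parameter used as slack: it keeps the truncation nonempty even if the least
  admissible bound is not attained.\<close>

definition pos :: 'a where
  "pos = (SOME p. 0 < p)"

lemma pos: "0 < pos"
  unfolding pos_def using gt_ex[of "0::'a"] by (rule someI_ex)

text \<open>A definable choice from a nonempty definable set: restrict to a bounded part, and take its
  infimum \<open>c\<close> or, if that is not attained, a point inside the longest interval to the right of \<open>c\<close>.\<close>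

definition truncate :: "('a \<Rightarrow> bool) \<Rightarrow> 'a \<Rightarrow> bool" where
  "truncate P x \<longleftrightarrow> P x \<and>
     (\<exists>t. is_inf (\<lambda>t. 0 \<le> t \<and> (\<exists>x. P x \<and> x \<le> t \<and> 0 \<le> x + t)) t \<and> x \<le> t + pos \<and> 0 \<le> x + (t + pos))"

definition select :: "('a \<Rightarrow> bool) \<Rightarrow> 'a \<Rightarrow> bool" where
  "select P a \<longleftrightarrow> (\<exists>c. is_inf (truncate P) c \<and>
     (truncate P c \<and> a = c \<or>
      \<not> truncate P c \<and> (\<exists>d h. is_sup (\<lambda>d. c < d \<and> (\<forall>x. c < x \<and> x < d \<longrightarrow> truncate P x)) d \<and>
        is_sup (\<lambda>h. c + (h + h) < d) h \<and> a = c + h)))"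

lemmas select_unfold = select_def truncate_def is_sup_def is_inf_def

lemma truncate:
  assumes def_P: "dpred M (\<lambda>e. P (e 0))" and "P x0"
  shows "\<exists>x. truncate P x" and "\<exists>q. \<forall>x. truncate P x \<longrightarrow> x \<le> q \<and> - q \<le> x"
proof -
  note dP = dpred_app[OF def_P]
  define T where "T t \<longleftrightarrow> 0 \<le> t \<and> (\<exists>x. P x \<and> x \<le> t \<and> 0 \<le> x + t)" for t
  \<comment> \<open>The absolute value of \<open>x0\<close> is an admissible bound.\<close>
  have T0: "T (if 0 \<le> x0 then x0 else - x0)"
  proof (cases "0 \<le> x0")
    case True
    then have "0 + 0 \<le> x0 + x0" using group_add_le_cancel_left[of x0 0 x0] by (auto intro: order_trans)
    then show ?thesis using True \<open>P x0\<close> unfolding T_def by auto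
  next
    case False
    then have x0: "x0 < 0" by simp
    then have "0 < - x0" using group_add_less_cancel_right[of x0 "- x0" 0] by simp
    then have "x0 \<le> - x0" using x0 by simp
    then show ?thesis using False \<open>0 < - x0\<close> \<open>P x0\<close> unfolding T_def by auto
  qed
  have def_T: "dpred M (\<lambda>e. T (e 0))" unfolding T_def by (intro dintros dP)
  obtain t where t: "is_inf T t"
    using ex_is_inf[OF def_T T0, of 0] unfolding T_def by blast
  have tr: "truncate P x \<longleftrightarrow> P x \<and> x \<le> t + pos \<and> 0 \<le> x + (t + pos)" for x
    unfolding truncate_def T_def[symmetric] using t is_inf_unique[OF t] by metis
  obtain t' where t': "T t'" "t' < t + pos"
    using is_inf_approx[OF t less_add_pos[OF pos]] by blast
  then obtain x where x: "P x" "x \<le> t'" "0 \<le> x + t'" unfolding T_def by blast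
  have "x + t' < x + (t + pos)" using t' by (simp add: group_add_order)
  then have "truncate P x" unfolding tr using x t'(2) by (meson order_trans less_imp_le order_le_less_trans)
  then show "\<exists>x. truncate P x" ..
  have "- (t + pos) \<le> x" if "0 \<le> x + (t + pos)" for x
    using group_add_le_cancel_right[of "- (t + pos)" "t + pos" x] that by simp
  then show "\<exists>q. \<forall>x. truncate P x \<longrightarrow> x \<le> q \<and> - q \<le> x" unfolding tr by blast
qed

lemma select:
  assumes def_P: "dpred M (\<lambda>e. P (e 0))" and "P x0"
  shows "\<exists>!a. select P a" and "select P a \<Longrightarrow> P a"
proof -
  note dP = dpred_app[OF def_P]
  have def_Q: "dpred M (\<lambda>e. truncate P (t e))" if "dterm M t" for t
  proof -
    have "dpred M (\<lambda>e. truncate P (e 0))"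
      unfolding truncate_def is_inf_def by (intro dintros dP)
    then show ?thesis using that by (rule dpred_app)
  qed
  obtain x where x: "truncate P x" using truncate(1)[OF assms] ..
  obtain q where q: "\<And>x. truncate P x \<Longrightarrow> x \<le> q \<and> - q \<le> x" using truncate(2)[OF assms] by blast
  obtain c where c: "is_inf (truncate P) c"
    using ex_is_inf[of "truncate P", OF def_Q x] dterm_var q by blast
  define D where "D d \<longleftrightarrow> c < d \<and> (\<forall>x. c < x \<and> x < d \<longrightarrow> truncate P x)" for d
  have sel: "select P a \<longleftrightarrow> truncate P c \<and> a = c \<or>
      \<not> truncate P c \<and> (\<exists>d h. is_sup D d \<and> is_sup (\<lambda>h. c + (h + h) < d) h \<and> a = c + h)" for a
    unfolding select_def D_def using c is_inf_unique[OF c] by blast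
  have "(\<exists>!a. select P a) \<and> (\<forall>a. select P a \<longrightarrow> truncate P a)"
  proof (cases "truncate P c")
    case True
    then show ?thesis unfolding sel by blast
  next
    case False
    obtain d0 where d0: "c < d0" "(\<forall>x. c < x \<and> x < d0 \<longrightarrow> truncate P x) \<or> (\<forall>x. c < x \<and> x < d0 \<longrightarrow> \<not> truncate P x)"
      using right_germ[of "truncate P" c] def_Q dterm_var by blast
    \<comment> \<open>A point of the truncation this close to its unattained infimum rules out the
      second alternative of the germ.\<close>
    obtain y where y: "truncate P y" "y < d0" using is_inf_approx[OF c d0(1)] by blast
    then have "c < y" using is_inf_lower[OF c y(1)] False by (metis order_le_less)
    then have D0: "D d0" unfolding D_def using d0 y by blast
    have upper: "d \<le> max q c" if "D d" for d
    proof (rule ccontr)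
      assume "\<not> d \<le> max q c"
      then obtain z where "max q c < z" "z < d" using dense by (meson not_le)
      then show False using \<open>D d\<close> q[of z] unfolding D_def by auto
    qed
    have "dpred M (\<lambda>e. D (e 0))" unfolding D_def by (intro dintros def_Q)
    then obtain d where d: "is_sup D d" using ex_is_sup D0 upper by blast
    have "c < d" using is_sup_upper[OF d D0] d0(1) by simp
    note h = half[OF this]
    obtain h where h1: "is_sup (\<lambda>h. c + (h + h) < d) h" using h(1) by blast
    have eq: "select P a \<longleftrightarrow> a = c + h" for a
      unfolding sel using False d h1 is_sup_unique[OF d] is_sup_unique[OF h1] by blast
    have "c + h < d" "c < c + h" using h(2)[OF h1] by auto
    then have "truncate P (c + h)" using is_sup_approx[OF d] unfolding D_def by blast
    then show ?thesis unfolding eq by blast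
  qed
  then show "\<exists>!a. select P a" and "select P a \<Longrightarrow> P a" unfolding truncate_def by blast+
qed

text \<open>\<open>Z\<close> is the graph of a choice function with parameters
  \<open>\<sigma>\<close>. The later coordinates are chosen from the projection, then
  \<open>select\<close> picks the first one; being first-order, it is uniform in all the
  others.\<close>

lemma definable_choice:
  assumes "drel M (n + p) Y"
  shows "\<exists>Z. drel M (n + p) Z \<and> (\<forall>\<sigma>. length \<sigma> = p \<longrightarrow>
    (\<forall>y. length y = n \<longrightarrow> Z (y @ \<sigma>) \<longrightarrow> Y (y @ \<sigma>)) \<and>
    ((\<exists>y. length y = n \<and> Y (y @ \<sigma>)) \<longrightarrow> (\<exists>!y. length y = n \<and> Z (y @ \<sigma>))))"
  using assms
proof (induction n arbitrary: Y)
  case 0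
  then show ?case by (intro exI[of _ Y]) auto
next
  case (Suc n)
  have def_Y: "drel M (Suc (n + p)) Y" using Suc.prems by simp
  note dY = drelD[OF def_Y]
  have def_Y1: "drel M (n + p) (\<lambda>l. \<exists>a. Y (a # l))"
    unfolding drel_def by (intro dintros dY) simp_all
  obtain Z where Z: "drel M (n + p) Z"
    "\<And>\<sigma> y. length \<sigma> = p \<Longrightarrow> length y = n \<Longrightarrow> Z (y @ \<sigma>) \<Longrightarrow> \<exists>a. Y (a # y @ \<sigma>)"
    "\<And>\<sigma> y. length \<sigma> = p \<Longrightarrow> length y = n \<Longrightarrow> \<exists>a. Y (a # y @ \<sigma>) \<Longrightarrow> \<exists>!y. length y = n \<and> Z (y @ \<sigma>)"
    using Suc.IH[OF def_Y1] by blast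
  define Z' where "Z' l \<longleftrightarrow> Z (tl l) \<and> select (\<lambda>a. Y (a # tl l)) (hd l)" for l
  have "drel M (Suc (n + p)) Z'"
    by (rule drel_SucI, unfold Z'_def list.sel select_unfold, intro dintros dY drelD[OF Z(1)]) simp_all
  moreover have dY': "dpred M (\<lambda>e. Y (e 0 # y @ \<sigma>))" if "length \<sigma> = p" "length y = n" for y \<sigma>
    by (intro dintros dY) (use that in simp_all)
  have "Y (y @ \<sigma>)" if len: "length \<sigma> = p" "length y = Suc n" and y: "Z' (y @ \<sigma>)" for y \<sigma>
  proof -
    obtain a y' where y': "y = a # y'" "length y' = n" using len by (auto simp: length_Suc_conv)
    have "Z (y' @ \<sigma>)" "select (\<lambda>a. Y (a # y' @ \<sigma>)) a" using y y' unfolding Z'_def by auto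
    then show ?thesis using Z(2)[OF len(1) y'(2)] select(2)[OF dY'[OF len(1) y'(2)]] y' by auto
  qed
  moreover have "\<exists>!y. length y = Suc n \<and> Z' (y @ \<sigma>)" if len: "length \<sigma> = p"
    and ex: "\<exists>y. length y = Suc n \<and> Y (y @ \<sigma>)" for \<sigma>
  proof -
    obtain a y where "length y = n" "Y (a # y @ \<sigma>)" using ex by (auto simp: length_Suc_conv)
    then obtain y' where y': "length y' = n" "Z (y' @ \<sigma>)"
      "\<And>z. length z = n \<Longrightarrow> Z (z @ \<sigma>) \<Longrightarrow> z = y'"
      using Z(3)[OF len, of y] by blast
    obtain b where "Y (b # y' @ \<sigma>)" using Z(2)[OF len y'(1,2)] by blast
    then obtain a' where a': "select (\<lambda>a. Y (a # y' @ \<sigma>)) a'"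
      "\<And>b. select (\<lambda>a. Y (a # y' @ \<sigma>)) b \<Longrightarrow> b = a'"
      using select(1)[OF dY'[OF len y'(1)]] by blast
    show ?thesis
    proof (rule ex1I[of _ "a' # y'"])
      show "length (a' # y') = Suc n \<and> Z' ((a' # y') @ \<sigma>)" using y'(1,2) a'(1) unfolding Z'_def by simp
      fix z assume z: "length z = Suc n \<and> Z' (z @ \<sigma>)"
      then obtain c w where w: "z = c # w" "length w = n" by (auto simp: length_Suc_conv)
      then have "w = y'" using y'(3)[of w] z unfolding Z'_def by simp
      then show "z = a' # y'" using a'(2)[of c] z w unfolding Z'_def by simp
    qed
  qed
  ultimately show ?case by (intro exI[of _ Z']) simp
qed

lemma ex_downward_cofinal:
  fixes \<Omega> :: "'a list set" and r :: "'a list rel"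
  assumes preord: "definable_preordered_set M n \<Omega> r" and dir: "downward_directed \<Omega> r"
  shows "\<exists>\<gamma>. definable_on_pos_pairs M n \<gamma> \<and> downward_cofinal pos_pairs pos_pairs_rel \<Omega> r \<gamma>"
proof -
  have \<Omega>: "definable M n \<Omega>" and pre: "preorder_on \<Omega> r"
    and r: "definable M (n + n) {x @ y | x y. (x, y) \<in> r}"
    using preord unfolding definable_preordered_set_def by auto
  note def_\<Omega> = drel_definable(1)[OF \<Omega>] and len = drel_definable(2)[OF \<Omega>]
  have refl: "(x, x) \<in> r" if "x \<in> \<Omega>" for x using pre that by (simp add: preorder_on_def refl_on_def)
  have trans: "(x, z) \<in> r" if "(x, y) \<in> r" "(y, z) \<in> r" for x y z
    using pre that unfolding preorder_on_def trans_def by blast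
  have field: "x \<in> \<Omega> \<and> y \<in> \<Omega>" if "(x, y) \<in> r" for x y
    using pre that unfolding preorder_on_def by (auto simp: refl_on_def)
  define R where "R l \<longleftrightarrow> l \<in> {x @ y | x y. (x, y) \<in> r}" for l
  have R: "R (x @ y) \<longleftrightarrow> (x, y) \<in> r" if "length x = n" for x y
    unfolding R_def by (rule append_mem_iff[OF _ that]) (use field len in blast)
  have def_R: "drel M (n + n) R" using drel_definable(1)[OF r] unfolding R_def .
  interpret definable_directed M n "\<lambda>v. v \<in> \<Omega>" "\<lambda>v w. (v, w) \<in> r"
  proof
    show "\<exists>v. v \<in> \<Omega>" using dir unfolding downward_directed_def by blast
    show "\<exists>z. z \<in> \<Omega> \<and> (z, v) \<in> r \<and> (z, w) \<in> r" if "v \<in> \<Omega>" "w \<in> \<Omega>" for v w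
    proof -
      have "\<exists>z\<in>\<Omega>. \<forall>u\<in>{v, w}. (z, u) \<in> r"
        using dir[unfolded downward_directed_def, THEN conjunct2, rule_format, of "{v, w}"] that by simp
      then show ?thesis by auto
    qed
  qed (use def_\<Omega> len in auto)
  \<comment> \<open>Points outside \<open>\<Omega>\<close> impose no condition, so the sets cover
    all lists of length \<open>n\<close>.\<close>
  define U where "U s t v x \<longleftrightarrow> (x \<in> \<Omega> \<longrightarrow> R (v @ x))" for s t :: 'a and v x
  have "dfam M n n U"
    by (rule dfamI, unfold U_def, intro dintros drelD[OF def_\<Omega>] drelD[OF def_R]) simp_all
  moreover have "monotone_cover {x. length x = n} U"
  proof (rule monotone_coverI; unfold U_def)
    fix s t :: 'a and v w x
    assume "v \<in> \<Omega>" "w \<in> \<Omega>" "(w, v) \<in> r" "x \<in> \<Omega> \<longrightarrow> R (v @ x)"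
    then show "x \<in> \<Omega> \<longrightarrow> R (w @ x)" using R len trans by blast
  next
    fix s t :: 'a and x
    show "\<exists>v. v \<in> \<Omega> \<and> (x \<in> \<Omega> \<longrightarrow> R (v @ x))"
      using \<Omega>_nonempty refl R len by (cases "x \<in> \<Omega>") blast+
  qed
  ultimately obtain K where K: "dfam M 0 n (\<lambda>s t _. K s t)" "exhausts K {x. length x = n}"
    "dominated K {x. length x = n} U" using ex_exhaustion by blast
  \<comment> \<open>The candidate values at given scales. The scales come last, as
    \<open>definable_choice\<close> expects of parameters.\<close>
  define Y where "Y l \<longleftrightarrow> take n l \<in> \<Omega> \<and>
    (\<forall>x. length x = n \<longrightarrow> K (l ! n) (l ! Suc n) x \<and> x \<in> \<Omega> \<longrightarrow> R (take n l @ x))" for l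
  have Y: "Y (y @ [s, t]) \<longleftrightarrow> y \<in> \<Omega> \<and> (\<forall>x. length x = n \<longrightarrow> K s t x \<and> x \<in> \<Omega> \<longrightarrow> (y, x) \<in> r)"
    if "length y = n" for y s t
    using that R by (simp add: Y_def nth_append)
  have "drel M (n + 2) Y"
  proof (rule drel_appendI)
    have "dpred M (\<lambda>e. map e [0..<n] \<in> \<Omega> \<and>
        (\<forall>x. length x = n \<longrightarrow> K (e n) (e (Suc n)) x \<and> x \<in> \<Omega> \<longrightarrow> R (map e [0..<n] @ x)))"
      by (intro dintros drelD[OF def_\<Omega>] drelD[OF def_R] dfamD[OF K(1), where v = "\<lambda>e. []"]) simp_all
    then show "dpred M (\<lambda>e. Y (map (\<lambda>i. e i) [0..<n] @ map (\<lambda>i. e (i + n)) [0..<2]))"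
      by (simp add: Y_def nth_append numeral_2_eq_2)
  qed
  from definable_choice[OF this] obtain Z where Z: "drel M (n + 2) Z"
    "\<And>\<sigma> y. length \<sigma> = 2 \<Longrightarrow> length y = n \<Longrightarrow> Z (y @ \<sigma>) \<Longrightarrow> Y (y @ \<sigma>)"
    "\<And>\<sigma> y. length \<sigma> = 2 \<Longrightarrow> length y = n \<Longrightarrow> Y (y @ \<sigma>) \<Longrightarrow> \<exists>!y. length y = n \<and> Z (y @ \<sigma>)"
    by blast
  define \<gamma> where "\<gamma> = (\<lambda>(s, t). THE y. length y = n \<and> Z (y @ [s, t]))"
  have ex1: "\<exists>!y. length y = n \<and> Z (y @ [s, t])" if st: "0 < s" "0 < t" for s t
  proof -
    obtain v where v: "v \<in> \<Omega>" "\<And>x. length x = n \<Longrightarrow> K s t x \<Longrightarrow> U s t v x"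
      by (rule dominatedE[OF K(3) st]) simp
    then have "Y (v @ [s, t])" using Y[OF len[OF v(1)]] R[OF len[OF v(1)]] unfolding U_def by blast
    then show ?thesis using Z(3)[of "[s, t]" v] len[OF v(1)] by simp
  qed
  have \<gamma>: "length (\<gamma> (s, t)) = n" "Z (\<gamma> (s, t) @ [s, t])"
    "\<And>y. length y = n \<Longrightarrow> Z (y @ [s, t]) \<Longrightarrow> y = \<gamma> (s, t)" if "0 < s" "0 < t" for s t
  proof -
    have \<gamma>_eq: "\<gamma> (s, t) = (THE y. length y = n \<and> Z (y @ [s, t]))" by (simp add: \<gamma>_def)
    show "length (\<gamma> (s, t)) = n" and "Z (\<gamma> (s, t) @ [s, t])"
      unfolding \<gamma>_eq using theI'[OF ex1[OF that]] by blast+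
    show "y = \<gamma> (s, t)" if "length y = n" "Z (y @ [s, t])" for y
      unfolding \<gamma>_eq
      by (rule the1_equality[OF ex1[OF \<open>0 < s\<close> \<open>0 < t\<close>], symmetric]) (use that in simp)
  qed
  have \<gamma>Y: "Y (\<gamma> (s, t) @ [s, t])" if "0 < s" "0 < t" for s t
    by (rule Z(2)) (use \<gamma>(1,2)[OF that] in simp_all)
  have \<gamma>\<Omega>: "\<gamma> (s, t) \<in> \<Omega>" if "0 < s" "0 < t" for s t
    using \<gamma>Y[OF that] unfolding Y[OF \<gamma>(1)[OF that]] by blast
  have "definable_on_pos_pairs M n \<gamma>"
  proof -
    \<comment> \<open>The graph lists the scales first while \<open>Z\<close> takes them last, so
      the variables are permuted.\<close>
    define P where "P e \<longleftrightarrow> 0 < e 0 \<and> 0 < e (Suc 0) \<and> Z (map (\<lambda>i. e (i + 2)) [0..<n] @ [e 0, e (Suc 0)])"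
      for e :: "nat \<Rightarrow> 'a"
    have "dpred M P" unfolding P_def by (intro dintros drelD[OF Z(1)]) simp_all
    then have "definable M (2 + n) {xs. length xs = 2 + n \<and> P (nth_default 0 xs)}" by (rule definableI)
    also have "{xs. length xs = 2 + n \<and> P (nth_default 0 xs)} = {[s, t] @ \<gamma> (s, t) | s t. (s, t) \<in> pos_pairs}"
    proof -
      have eq: "P (nth_default 0 (s # t # y)) \<longleftrightarrow> 0 < s \<and> 0 < t \<and> Z (y @ [s, t])" if "length y = n" for s t y
      proof -
        have "map (\<lambda>i. nth_default 0 (s # t # y) (i + 2)) [0..<n] = y"
          using that by (intro nth_equalityI) (simp_all add: nth_default_def)
        then show ?thesis unfolding P_def by simp
      qed
      show ?thesis
      proof (intro set_eqI iffI)
        fix xs assume "xs \<in> {xs. length xs = 2 + n \<and> P (nth_default 0 xs)}"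
        then obtain s t y where xs: "xs = s # t # y" "length y = n" "P (nth_default 0 (s # t # y))"
          by (auto simp: length_Suc_conv numeral_2_eq_2)
        then have P: "0 < s" "0 < t" "Z (y @ [s, t])" using eq[of y s t] by auto
        then have "y = \<gamma> (s, t)" by (rule \<gamma>(3)[OF _ _ xs(2)])
        then show "xs \<in> {[s, t] @ \<gamma> (s, t) | s t. (s, t) \<in> pos_pairs}"
          using xs P by (auto simp: pos_pairs_def)
      next
        fix xs assume "xs \<in> {[s, t] @ \<gamma> (s, t) | s t. (s, t) \<in> pos_pairs}"
        then obtain s t where st: "0 < s" "0 < t" "xs = s # t # \<gamma> (s, t)" by (auto simp: pos_pairs_def)
        then show "xs \<in> {xs. length xs = 2 + n \<and> P (nth_default 0 xs)}"
          using eq[OF \<gamma>(1)[OF st(1,2)], of s t] \<gamma>(1,2)[OF st(1,2)] by simp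
      qed
    qed
    finally show ?thesis unfolding definable_on_pos_pairs_def .
  qed
  moreover have "downward_cofinal pos_pairs pos_pairs_rel \<Omega> r \<gamma>"
    unfolding downward_cofinal_def
  proof (intro conjI ballI)
    show "\<gamma> \<in> pos_pairs \<rightarrow> \<Omega>" using \<gamma>\<Omega> by (auto simp: pos_pairs_def)
    fix u assume u: "u \<in> \<Omega>"
    then obtain s0 t0 where st0: "0 < s0" "0 < t0" "K s0 t0 u" using exhausts_ex[OF K(2)] len by blast
    \<comment> \<open>At finer scales \<open>u\<close> still lies in \<open>K s t\<close>, where
      \<open>\<gamma> (s, t)\<close> is a lower bound by choice.\<close>
    have "(\<gamma> (s, t), u) \<in> r" if st: "0 < s" "0 < t" "s \<le> s0" "t0 \<le> t" for s t
    proof -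
      have "K s t u" using exhausts_mono[OF K(2) _ st(1,3) st0(2) st(4) st0(3)] len[OF u] by simp
      then show ?thesis using \<gamma>Y[OF st(1,2)] Y[OF \<gamma>(1)[OF st(1,2)]] u len[OF u] by blast
    qed
    then have "\<forall>w\<in>pos_pairs. (w, (s0, t0)) \<in> pos_pairs_rel \<longrightarrow> (\<gamma> w, u) \<in> r"
      by (auto simp: pos_pairs_rel_def pos_pairs_def)
    moreover have "(s0, t0) \<in> pos_pairs" using st0 by (simp add: pos_pairs_def)
    ultimately show "\<exists>v\<in>pos_pairs. \<forall>w\<in>pos_pairs. (w, v) \<in> pos_pairs_rel \<longrightarrow> (\<gamma> w, u) \<in> r" by blast
  qed
  ultimately show ?thesis by blast
qed

text \<open>Exchanging the two blocks of \<open>n\<close> variables is a substitution. This reduces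
  the upward case to the downward one.\<close>

lemma definable_preordered_set_converse:
  fixes \<Omega> :: "'a list set" and r :: "'a list rel"
  assumes "definable_preordered_set M n \<Omega> r"
  shows "definable_preordered_set M n \<Omega> (r\<inverse>)"
proof -
  have \<Omega>: "definable M n \<Omega>" and pre: "preorder_on \<Omega> r"
    and r: "definable M (n + n) {x @ y | x y. (x, y) \<in> r}"
    using assms unfolding definable_preordered_set_def by auto
  have len: "length x = n" "length y = n" if "(x, y) \<in> r" for x y
    using pre that drel_definable(2)[OF \<Omega>] unfolding preorder_on_def by (auto simp: refl_on_def)
  have "dpred M (\<lambda>e. map (\<lambda>i. e (i + n)) [0..<n] @ map (\<lambda>i. e i) [0..<n] \<in> {x @ y | x y. (x, y) \<in> r})"
    by (intro drelD[OF drel_definable(1)[OF r]] dintros) simp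
  then have "definable M (n + n) {xs. length xs = n + n \<and>
      map (\<lambda>i. nth_default 0 xs (i + n)) [0..<n] @ map (\<lambda>i. nth_default 0 xs i) [0..<n]
        \<in> {x @ y | x y. (x, y) \<in> r}}" (is "definable M _ ?S")
    by (rule definableI)
  also have "?S = {x @ y | x y. (x, y) \<in> r\<inverse>}"
  proof (rule set_eqI)
    fix xs
    show "xs \<in> ?S \<longleftrightarrow> xs \<in> {x @ y | x y. (x, y) \<in> r\<inverse>}"
    proof (cases "length xs = n + n")
      case True
      define x y where "x = take n xs" and "y = drop n xs"
      have xy: "xs = x @ y" "length x = n" "length y = n" using True by (auto simp: x_def y_def)
      have "map (\<lambda>i. nth_default 0 xs (i + n)) [0..<n] = y"
        and "map (\<lambda>i. nth_default 0 xs i) [0..<n] = x"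
        using xy by (auto intro!: nth_equalityI simp: nth_default_def nth_append)
      then have "xs \<in> ?S \<longleftrightarrow> y @ x \<in> {x @ y | x y. (x, y) \<in> r}"
        using True by simp
      also have "\<dots> \<longleftrightarrow> (y, x) \<in> r"
        by (rule append_mem_iff) (use len xy in auto)
      also have "\<dots> \<longleftrightarrow> x @ y \<in> {x @ y | x y. (x, y) \<in> r\<inverse>}"
        using append_mem_iff[of "r\<inverse>" n x y] len xy by simp
      finally show ?thesis unfolding xy(1) .
    next
      case False
      then show ?thesis using len by auto
    qed
  qed
  finally show ?thesis
    using \<Omega> pre unfolding definable_preordered_set_def preorder_on_def by (auto simp: refl_on_def)
qed

end

theorem theorem3p2:
  fixes M :: "('a::{linordered_group_add, unbounded_dense_linorder}, 'f, 'r) expansion"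
    and n :: nat
    and \<Omega> :: "'a list set"
    and r :: "'a list rel"
  assumes "o_minimal M"
    and "definable_preordered_set M n \<Omega> r"
  shows "(downward_directed \<Omega> r \<longrightarrow>
            (\<exists>\<gamma>. definable_on_pos_pairs M n \<gamma> \<and>
                 downward_cofinal pos_pairs pos_pairs_rel \<Omega> r \<gamma>)) \<and>
         (upward_directed \<Omega> r \<longrightarrow>
            (\<exists>\<gamma>. definable_on_pos_pairs M n \<gamma> \<and>
                 upward_cofinal pos_pairs pos_pairs_rel \<Omega> r \<gamma>))"
proof -
  interpret o_minimal_expansion M using assms(1) by unfold_locales
  have "upward_cofinal pos_pairs pos_pairs_rel \<Omega> r \<gamma> \<longleftrightarrow>
      downward_cofinal pos_pairs pos_pairs_rel \<Omega> (r\<inverse>) \<gamma>" for \<gamma> :: "'a \<times> 'a \<Rightarrow> 'a list"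
    unfolding upward_cofinal_def downward_cofinal_def by simp
  then show ?thesis
    using ex_downward_cofinal[OF assms(2)]
      ex_downward_cofinal[OF definable_preordered_set_converse[OF assms(2)]]
    unfolding upward_directed_def by simp
qed

end
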